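(* Assume (A1), (A2), (A3) (see context) and let $\zeta\ge 0$. Then $$\mathbb E_0\Big[\sum_{x\in\xi:\,x\sim 0}|x|^\zeta\Big]<+\infty$$ (here $x\sim 0$ refers to adjacency in $\mathrm{DT}(\xi)$) provided at least one of the following holds: (H1) $\rho_\gamma<+\infty$ for some $\gamma>2$, and Condition $C(\alpha)$ holds for some $\alpha>\frac{\gamma}{\gamma-2}(d+\zeta)$; (H2) $\rho_2<+\infty$ and $\mathbb P$ has finite range of dependence; (H3) $\rho_2<+\infty$, $\mathbb P$ has positive association, and Condition $C(\alpha)$ holds for some $\alpha>d+\zeta$.
   Context: Notation: $|\cdot|$ is the Euclidean norm on $\mathbb R^d$, $\Lambda_r=[-r,r]^d$. $\mathcal N$ is the set of locally finite subsets of $\mathbb R^d$; $\xi\in\mathcal N$ is identified with the counting measure $\sum_{x\in\xi}\delta_x$, so $\xi(A)=\#(\xi\cap A)$; $\mathcal N$ carries the $\sigma$-algebra generated by the maps $\xi\mapsto\xi(A)$, $A$ Borel. Translations: $\tau_x\xi:=\xi-x$. For $\xi\in\mathcal N$, $x\in\xi$, the Voronoi cell is $\mathrm{Vor}(x|\xi)=\{y\in\mathbb R^d:|y-x|\le|y-z|\ \forall z\in\xi\}$. The Delaunay triangulation $\mathrm{DT}(\xi)$ is the graph with vertex set $\xi$ and edges the pairs $\{x,y\}$, $x\neq y$ in $\xi$, such that $\mathrm{Vor}(x|\xi)$ and $\mathrm{Vor}(y|\xi)$ share a $(d-1)$-dimensional face; write $x\sim y$. Setting: $(\Omega,\mathcal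 F,\mathcal P)$ is a probability space with a measurable action $(\theta_x)_{x\in\mathbb R^d}$ of $\mathbb R^d$ ($\theta_0=\mathrm{id}$, $\theta_x\circ\theta_y=\theta_{x+y}$, $(x,\omega)\mapsto\theta_x\omega$ measurable); $\omega\mapsto\hat\omega\in\mathcal N$ is a simple point process on it with law $\mathbb P$ (expectation $\mathbb E$); $(\omega,x,y)\mapsto c_{x,y}(\omega)\in[0,\infty)$ is a measurable symmetric conductance field, with $c_{x,x}=0$ and $c_{x,y}(\omega)=0$ if $\{x,y\}$ is not an edge of $\mathrm{DT}(\hat\omega)$. Assumptions: (A1) $\mathcal P(\theta_xA)=\mathcal P(A)$ for all $x,A$, and $\mathcal P(\hat\omega=\emptyset)=0$; (A2) the intensity $m:=\mathbb E[\xi([0,1]^d)]$ lies in $(0,\infty)$; (A3) there is a measurable $\Omega_*$ with $\theta_x\Omega_*=\Omega_*$ for all $x$ and $\mathcal P(\Omega_* )=1$ such that for every $\omega\in\Omega_*$: $\widehat{\theta_x\omega}=\tau_x\hat\omega$ for all $x$, and $c_{y-x,z-x}(\theta_x\omega)=c_{y,z}(\omega)$ for all $x$ and all edges $\{y,z\}$ of $\mathrm{DT}(\hat\omega)$. The Palm distribution $\mathbb P_0$ of $\mathbb P$ is the probability on $\mathcal N$ given by $\mathbb P_0(A)=\frac1m\int d\mathbb P(\xi)\sum_{x\in\xi\cap[0,1]^d}\mathbf 1_A(\tau_x\xi)$; it is concentrated on $\{\xi:0\in\xi\}$; $\mathbb E_0$ is its expectation. $\rho_\gamma:=\mathbb E[\xi([0,1]^d)^\gamma]$.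 Condition $C(\alpha)$ ($\alpha>0$): there is $\kappa>0$ with $\mathbb P(\xi(\Lambda_\ell)=0)\le\kappa\ell^{-\alpha}$ for all $\ell\ge1$. $\mathbb P$ has finite range of dependence if there is $L>0$ such that for all Borel $A,B\subset\mathbb R^d$ at Euclidean distance at least $L$, the random sets $\xi\cap A$ and $\xi\cap B$ are independent under $\mathbb P$. $\mathbb P$ has positive association if for all $n,k\ge0$, all weakly increasing $f:\mathbb R_+^n\to\mathbb R$, $g:\mathbb R_+^k\to\mathbb R$ and all pairwise disjoint bounded Borel sets $A_1,\dots,A_n,B_1,\dots,B_k$, $\mathrm{Cov}(f(\xi(A_1),\dots,\xi(A_n)),g(\xi(B_1),\dots,\xi(B_k)))\ge0$ whenever both variables have finite second moment under $\mathbb P$. *)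

theory Defs
  imports "HOL-Probability.Probability"
begin

definition Lam :: "real \<Rightarrow> 'a::euclidean_space set" where
  "Lam r = cbox (- (r *\<^sub>R One)) (r *\<^sub>R One)"

definition unit_cube :: "'a::euclidean_space set" where
  "unit_cube = cbox 0 One"

definition locfin :: "'a::euclidean_space set \<Rightarrow> bool" where
  "locfin \<xi> \<longleftrightarrow> (\<forall>A. bounded A \<longrightarrow> finite (\<xi> \<inter> A))"

text \<open>Counting measure xi(A) (for bounded A; finite for locally finite xi).\<close>
definition cnt :: "'a set \<Rightarrow> 'a set \<Rightarrow> nat" where
  "cnt \<xi> A = card (\<xi> \<inter> A)"

definition NN :: "'a::euclidean_space set measure" where
  "NN = sigma {\<xi>. locfin \<xi>}
     {{\<xi>. locfin \<xi> \<and> cnt \<xi> A = k} | A k. A \<in> sets borel \<and> bounded A}"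

definition tau :: "'a::euclidean_space \<Rightarrow> 'a set \<Rightarrow> 'a set" where
  "tau x \<xi> = (\<lambda>y. y - x) ` \<xi>"

definition Vor :: "'a::euclidean_space \<Rightarrow> 'a set \<Rightarrow> 'a set" where
  "Vor x \<xi> = {y. \<forall>z\<in>\<xi>. norm (y - x) \<le> norm (y - z)}"

definition dt_adj :: "'a::euclidean_space set \<Rightarrow> 'a \<Rightarrow> 'a \<Rightarrow> bool" where
  "dt_adj \<xi> x y \<longleftrightarrow> x \<in> \<xi> \<and> y \<in> \<xi> \<and> x \<noteq> y \<and>
     aff_dim (Vor x \<xi> \<inter> Vor y \<xi>) = int DIM('a) - 1"

definition intensity :: "'a::euclidean_space set measure \<Rightarrow> ennreal" where
  "intensity P = (\<integral>\<^sup>+ \<xi>. ennreal (real (cnt \<xi> unit_cube)) \<partial>P)"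

definition rho :: "'a::euclidean_space set measure \<Rightarrow> real \<Rightarrow> ennreal" where
  "rho P \<gamma> = (\<integral>\<^sup>+ \<xi>. ennreal (real (cnt \<xi> unit_cube) powr \<gamma>) \<partial>P)"

definition palm_exp :: "'a::euclidean_space set measure \<Rightarrow> ('a set \<Rightarrow> ennreal) \<Rightarrow> ennreal" where
  "palm_exp P f =
     (\<integral>\<^sup>+ \<xi>. (\<Sum>x\<in>\<xi> \<inter> unit_cube. f (tau x \<xi>)) \<partial>P) / intensity P"

definition cond_C :: "'a::euclidean_space set measure \<Rightarrow> real \<Rightarrow> bool" where
  "cond_C P \<alpha> \<longleftrightarrow> (\<exists>\<kappa>>0. \<forall>l::real. l \<ge> 1 \<longrightarrow>
      measure P {\<xi>\<in>space P. cnt \<xi> (Lam l) = 0} \<le> \<kappa> * l powr (- \<alpha>))"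

definition finite_range_dep :: "'a::euclidean_space set measure \<Rightarrow> bool" where
  "finite_range_dep P \<longleftrightarrow> (\<exists>L>0. \<forall>A B. A \<in> sets borel \<longrightarrow> B \<in> sets borel \<longrightarrow>
      setdist A B \<ge> L \<longrightarrow>
      prob_space.indep_var P NN (\<lambda>\<xi>. \<xi> \<inter> A) NN (\<lambda>\<xi>. \<xi> \<inter> B))"

definition nonneg_vecs :: "nat \<Rightarrow> (nat \<Rightarrow> real) set" where
  "nonneg_vecs n = {v. (\<forall>i<n. 0 \<le> v i) \<and> (\<forall>i\<ge>n. v i = 0)}"

definition weakly_incr :: "nat \<Rightarrow> ((nat \<Rightarrow> real) \<Rightarrow> real) \<Rightarrow> bool" where
  "weakly_incr n f \<longleftrightarrow> (\<forall>u\<in>nonneg_vecs n. \<forall>v\<in>nonneg_vecs n.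
      (\<forall>i<n. u i \<le> v i) \<longrightarrow> f u \<le> f v)"

definition count_vec :: "nat \<Rightarrow> (nat \<Rightarrow> 'a set) \<Rightarrow> 'a set \<Rightarrow> nat \<Rightarrow> real" where
  "count_vec n A \<xi> = (\<lambda>i. if i < n then real (cnt \<xi> (A i)) else 0)"

definition positive_assoc :: "'a::euclidean_space set measure \<Rightarrow> bool" where
  "positive_assoc P \<longleftrightarrow> (\<forall>n k f g A B.
      weakly_incr n f \<longrightarrow> weakly_incr k g \<longrightarrow>
      (\<forall>i<n. A i \<in> sets borel \<and> bounded (A i)) \<longrightarrow>
      (\<forall>j<k. B j \<in> sets borel \<and> bounded (B j)) \<longrightarrow>
      (\<forall>i<n. \<forall>i'<n. i \<noteq> i' \<longrightarrow> A i \<inter> A i' = {}) \<longrightarrow>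
      (\<forall>j<k. \<forall>j'<k. j \<noteq> j' \<longrightarrow> B j \<inter> B j' = {}) \<longrightarrow>
      (\<forall>i<n. \<forall>j<k. A i \<inter> B j = {}) \<longrightarrow>
      integrable P (\<lambda>\<xi>. (f (count_vec n A \<xi>))\<^sup>2) \<longrightarrow>
      integrable P (\<lambda>\<xi>. (g (count_vec k B \<xi>))\<^sup>2) \<longrightarrow>
      (\<integral>\<xi>. f (count_vec n A \<xi>) * g (count_vec k B \<xi>) \<partial>P)
        - (\<integral>\<xi>. f (count_vec n A \<xi>) \<partial>P) * (\<integral>\<xi>. g (count_vec k B \<xi>) \<partial>P) \<ge> 0)"

definition setting ::
  "'w measure \<Rightarrow> ('a::euclidean_space \<Rightarrow> 'w \<Rightarrow> 'w) \<Rightarrow> ('w \<Rightarrow> 'a set)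
     \<Rightarrow> ('w \<Rightarrow> 'a \<Rightarrow> 'a \<Rightarrow> real) \<Rightarrow> bool" where
  "setting \<Omega> \<theta> hat c \<longleftrightarrow>
     prob_space \<Omega> \<and>
     \<comment> \<open>measurable action of R^d\<close>
     (\<forall>\<omega>\<in>space \<Omega>. \<theta> 0 \<omega> = \<omega>) \<and>
     (\<forall>x y. \<forall>\<omega>\<in>space \<Omega>. \<theta> x (\<theta> y \<omega>) = \<theta> (x + y) \<omega>) \<and>
     (\<lambda>(x, \<omega>). \<theta> x \<omega>) \<in> measurable (borel \<Otimes>\<^sub>M \<Omega>) \<Omega> \<and>
     \<comment> \<open>simple point process\<close>
     hat \<in> measurable \<Omega> NN \<and>
     \<comment> \<open>measurable symmetric conductance field supported on DT edges\<close>
     (\<lambda>(\<omega>, x, y). c \<omega> x y) \<in> borel_measurable (\<Omega> \<Otimes>\<^sub>M borel \<Otimes>\<^sub>M borel) \<and>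
     (\<forall>\<omega>\<in>space \<Omega>. \<forall>x y. 0 \<le> c \<omega> x y \<and> c \<omega> x y = c \<omega> y x \<and> c \<omega> x x = 0 \<and>
         (\<not> dt_adj (hat \<omega>) x y \<longrightarrow> c \<omega> x y = 0)) \<and>
     \<comment> \<open>(A1)\<close>
     (\<forall>x. \<forall>A\<in>sets \<Omega>. emeasure \<Omega> (\<theta> x ` A) = emeasure \<Omega> A) \<and>
     emeasure \<Omega> {\<omega>\<in>space \<Omega>. hat \<omega> = {}} = 0 \<and>
     \<comment> \<open>(A2)\<close>
     0 < intensity (distr \<Omega> NN hat) \<and> intensity (distr \<Omega> NN hat) < \<infinity> \<and>
     \<comment> \<open>(A3)\<close>
     (\<exists>\<Omega>s\<in>sets \<Omega>. (\<forall>x. \<theta> x ` \<Omega>s = \<Omega>s) \<and> emeasure \<Omega> \<Omega>s = 1 \<and>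
        (\<forall>\<omega>\<in>\<Omega>s. (\<forall>x. hat (\<theta> x \<omega>) = tau x (hat \<omega>)) \<and>
           (\<forall>x y z. dt_adj (hat \<omega>) y z \<longrightarrow> c (\<theta> x \<omega>) (y - x) (z - x) = c \<omega> y z)))"

end

theory Submission
  imports Defs
begin

text \<open>
  If \<open>y\<close> is a Delaunay neighbour of \<open>x\<close>, then a common point of the two Voronoi cells is the centre of
  an open ball without points of the process that has \<open>x\<close> on its boundary and radius at least
  \<open>|y - x| / 2\<close>. Approximating the direction of its centre by a finite net of the sphere, an edge of
  length of order \<open>2^k\<close> starting in the unit cube forces one of boundedly many deterministic boxes of
  side of order \<open>2^k\<close> to be empty, and this box is far from both end points. It remains to bound
  \<open>E[N_0 N_z; box empty]\<close>, where \<open>N_z\<close> counts the points in \<open>z + [0,1]^d\<close>, by a multiple of \<open>l^(-\<beta>)\<close>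
  with \<open>\<beta> > d + \<zeta>\<close> and \<open>l\<close> the size of the box: there are of order \<open>2^(k d)\<close> relevant cubes in the
  \<open>k\<close>-th shell, so the sum over the shells is dominated by a geometric series. Under (H1) the bound
  follows by truncating \<open>N_0 N_z\<close>. Under (H3) the emptiness of the box is a decreasing event, hence
  negatively correlated with \<open>N_0 N_z\<close>. Under (H2) it is independent of \<open>N_0 N_z\<close>, and
  \<open>p(3 l) \<le> p(l)^2\<close> for the void probabilities \<open>p\<close> makes them decay faster than any power.
\<close>

section \<open>Unit cells, boxes and the integer lattice\<close>

definition cell :: "'a::euclidean_space \<Rightarrow> 'a set" where
  "cell z = cbox z (z + One)"

definition box_at :: "'a::euclidean_space \<Rightarrow> real \<Rightarrow> 'a set" where
  "box_at b l = cbox (b - l *\<^sub>R One) (b + l *\<^sub>R One)"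

definition lattice_pts :: "nat \<Rightarrow> 'a::euclidean_space set" where
  "lattice_pts M = (\<lambda>f. \<Sum>i\<in>Basis. real_of_int (f i) *\<^sub>R i) ` (Basis \<rightarrow>\<^sub>E {- int M..int M})"

text \<open>The two requirements serve the correlation arguments: disjointness of \<open>A\<close>
  and \<open>B\<close> is asked for by positive association, distance from \<open>C\<close> by
  independence at finite range. For \<open>L > 0\<close> the distance condition also makes
  \<open>C\<close> disjoint from \<open>A\<close> and \<open>B\<close>.\<close>

definition separated :: "real \<Rightarrow> 'a::euclidean_space set \<Rightarrow> 'a set \<Rightarrow> 'a set \<Rightarrow> bool" where
  "separated L A B C \<longleftrightarrow> A \<inter> B = {} \<and> (\<forall>a\<in>A \<union> B. \<forall>c\<in>C. L \<le> dist a c)"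

lemma unit_cube_eq_cell: "unit_cube = cell 0"
  by (simp add: unit_cube_def cell_def)

lemma cell_translate: "cell z = (+) z ` unit_cube"
  using cbox_translation[of z 0 One] by (simp add: unit_cube_def cell_def)

lemma box_at_translate: "box_at b l = (+) b ` Lam l"
  using cbox_translation[of b "- (l *\<^sub>R One)" "l *\<^sub>R One"] by (simp add: box_at_def Lam_def)

lemma mem_cell: "y \<in> cell z \<longleftrightarrow> (\<forall>i\<in>Basis. z \<bullet> i \<le> y \<bullet> i \<and> y \<bullet> i \<le> z \<bullet> i + 1)"
  by (auto simp: cell_def mem_box inner_simps)

lemma mem_box_at: "y \<in> box_at b l \<longleftrightarrow> (\<forall>i\<in>Basis. \<bar>(y - b) \<bullet> i\<bar> \<le> l)"
  by (fastforce simp: box_at_def mem_box inner_simps abs_le_iff algebra_simps)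

lemma mem_Lam: "y \<in> Lam l \<longleftrightarrow> (\<forall>i\<in>Basis. \<bar>y \<bullet> i\<bar> \<le> l)"
  by (fastforce simp: Lam_def mem_box inner_simps abs_le_iff algebra_simps)

lemma norm_le_DIM:
  fixes x :: "'a::euclidean_space"
  assumes "\<And>i. i \<in> Basis \<Longrightarrow> \<bar>x \<bullet> i\<bar> \<le> l"
  shows "norm x \<le> real DIM('a) * l"
  using norm_le_l1[of x] sum_bounded_above[of Basis "\<lambda>i. \<bar>x \<bullet> i\<bar>" l] assms by simp

lemma dist_cell_le:
  fixes z :: "'a::euclidean_space"
  assumes "x \<in> cell z" "y \<in> cell z"
  shows "dist x y \<le> real DIM('a)"
proof -
  have "norm (x - y) \<le> real DIM('a) * 1"
  proof (rule norm_le_DIM)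
    fix i :: 'a assume "i \<in> Basis"
    with assms have "z \<bullet> i \<le> x \<bullet> i \<and> x \<bullet> i \<le> z \<bullet> i + 1" "z \<bullet> i \<le> y \<bullet> i \<and> y \<bullet> i \<le> z \<bullet> i + 1"
      unfolding mem_cell by blast+
    then show "\<bar>(x - y) \<bullet> i\<bar> \<le> 1" by (auto simp: inner_simps abs_le_iff)
  qed
  then show ?thesis by (simp add: dist_norm)
qed

lemma locfin_finite: "locfin \<xi> \<Longrightarrow> bounded A \<Longrightarrow> finite (\<xi> \<inter> A)"
  by (simp add: locfin_def)

text \<open>Finiteness matters because \<open>card\<close> of an infinite set is \<open>0\<close> by
  convention.\<close>

lemma cnt_eq_0_iff: "locfin \<xi> \<Longrightarrow> bounded A \<Longrightarrow> cnt \<xi> A = 0 \<longleftrightarrow> \<xi> \<inter> A = {}"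
  by (simp add: cnt_def locfin_finite)

lemma cnt_tau: "cnt (tau z \<xi>) A = cnt \<xi> ((+) z ` A)"
proof -
  have "tau z \<xi> \<inter> A = (\<lambda>y. y - z) ` (\<xi> \<inter> (+) z ` A)"
    by (force simp: tau_def)
  then show ?thesis unfolding cnt_def
    by (simp add: card_image inj_on_def)
qed

lemma lattice_pts_finite [simp]: "finite (lattice_pts M)"
  by (auto simp: lattice_pts_def intro!: finite_imageI finite_PiE)

lemma card_lattice_pts: "card (lattice_pts M :: 'a::euclidean_space set) \<le> (2 * M + 1) ^ DIM('a)"
proof -
  have "card (lattice_pts M :: 'a set) \<le> card ((Basis :: 'a set) \<rightarrow>\<^sub>E {- int M..int M})"
    unfolding lattice_pts_def by (intro card_image_le finite_PiE) auto
  also have "\<dots> = (2 * M + 1) ^ DIM('a)"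
    by (simp add: card_PiE nat_add_distrib nat_mult_distrib)
  finally show ?thesis .
qed

text \<open>The corner \<open>z\<close> is the coordinatewise floor of \<open>y\<close>. Closed
  cells overlap on their faces, but upper bounds only need them to cover.\<close>

lemma lattice_cell_cover:
  fixes y :: "'a::euclidean_space"
  assumes "\<And>i. i \<in> Basis \<Longrightarrow> \<bar>y \<bullet> i\<bar> \<le> real M"
  obtains z where "z \<in> lattice_pts M" "y \<in> cell z"
proof
  define f where "f = restrict (\<lambda>i. \<lfloor>y \<bullet> i\<rfloor>) (Basis :: 'a set)"
  have "\<lfloor>y \<bullet> i\<rfloor> \<in> {- int M..int M}" if "i \<in> Basis" for i
    using assms[OF that] by (auto simp: abs_le_iff le_floor_iff floor_le_iff)
  then have f: "f \<in> Basis \<rightarrow>\<^sub>E {- int M..int M}" by (auto simp: f_def)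
  then show "(\<Sum>i\<in>Basis. real_of_int (f i) *\<^sub>R i) \<in> lattice_pts M"
    unfolding lattice_pts_def by blast
  show "y \<in> cell (\<Sum>i\<in>Basis. real_of_int (f i) *\<^sub>R i)"
    unfolding mem_cell by (auto simp: f_def)
qed

section \<open>Empty boxes near Delaunay edges\<close>

text \<open>Let \<open>q\<close> be a common point of the two cells. No point of
  \<open>\<eta>\<close> is closer to \<open>q\<close> than \<open>0\<close> and \<open>w\<close>,
  both at distance \<open>norm q\<close>, so \<open>norm w \<le> 2 * norm q\<close>. Shrinking this
  empty open ball towards its boundary point \<open>0\<close> down to radius \<open>\<rho>\<close>
  keeps it inside the large ball; the new centre is \<open>\<rho>\<close> times the direction of
  \<open>q\<close>.\<close>

lemma empty_tangent_ball:
  fixes w :: "'a::euclidean_space"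
  assumes adj: "dt_adj \<eta> w 0" and \<rho>: "0 \<le> \<rho>" "2 * \<rho> \<le> norm w"
  obtains u where "norm u = 1" "\<And>v. v \<in> \<eta> \<Longrightarrow> \<rho> \<le> dist v (\<rho> *\<^sub>R u)"
proof -
  have mem: "w \<in> \<eta>" "0 \<in> \<eta>" "w \<noteq> 0"
    and dim: "aff_dim (Vor w \<eta> \<inter> Vor 0 \<eta>) = int DIM('a) - 1"
    using adj by (auto simp: dt_adj_def)
  \<comment> \<open>The empty set has affine dimension \<open>-1\<close>, while
    \<open>DIM('a) - 1 \<ge> 0\<close>.\<close>
  have "Vor w \<eta> \<inter> Vor 0 \<eta> \<noteq> {}"
    using dim by (metis DIM_positive aff_dim_empty diff_ge_0_iff_ge int_one_le_iff_zero_less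
        neg_0_le_iff_le not_one_le_zero of_nat_0_less_iff)
  then obtain q where q: "q \<in> Vor w \<eta>" "q \<in> Vor 0 \<eta>" by blast
  have near: "norm q \<le> norm (q - v)" if "v \<in> \<eta>" for v using q that by (auto simp: Vor_def)
  have "norm (q - w) = norm q" using q mem by (force simp: Vor_def)
  then have "norm w \<le> 2 * norm q" using norm_triangle_ineq4[of q "q - w"] by simp
  with \<rho> mem have q\<rho>: "\<rho> \<le> norm q" "q \<noteq> 0" by auto
  show thesis
  proof
    show "norm (q /\<^sub>R norm q) = 1" using q\<rho> by simp
    fix v assume "v \<in> \<eta>"
    have "norm (q - \<rho> *\<^sub>R (q /\<^sub>R norm q)) = norm ((1 - \<rho> / norm q) *\<^sub>R q)"
      by (simp add: algebra_simps divide_inverse)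
    also have "\<dots> = norm q - \<rho>" using q\<rho> by (simp add: field_simps)
    finally have "dist q (\<rho> *\<^sub>R (q /\<^sub>R norm q)) = norm q - \<rho>" by (simp add: dist_norm)
    moreover have "norm q \<le> dist q v" using near[OF \<open>v \<in> \<eta>\<close>] by (simp add: dist_norm)
    ultimately show "\<rho> \<le> dist v (\<rho> *\<^sub>R (q /\<^sub>R norm q))"
      using dist_triangle[of q v "\<rho> *\<^sub>R (q /\<^sub>R norm q)"] by (simp add: dist_commute)
  qed
qed

text \<open>The box stays within \<open>\<rho> / 2\<close> of the centre of the empty ball:
  \<open>\<rho> / 8\<close> pays for moving \<open>x\<close> to the origin, since
  \<open>norm x \<le> d\<close>, \<open>\<rho> / 8\<close> for replacing the direction by a point of
  the net, and \<open>\<rho> / 4\<close> for the extent of the box, whence its half-side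
  \<open>\<rho> / (4 * d)\<close>. The other \<open>\<rho> / 2\<close> keeps all points of
  \<open>\<xi>\<close> away from it. Given \<open>s\<close>, the box does not depend on
  \<open>\<xi>\<close>.\<close>

lemma empty_box_near_edge:
  fixes w :: "'a::euclidean_space" and S :: "'a set"
  defines "d \<equiv> real DIM('a)"
  assumes adj: "dt_adj (tau x \<xi>) w 0" and x: "x \<in> unit_cube" and y: "x + w \<in> cell z"
    and \<rho>: "2 * \<rho> \<le> norm w" "8 * d \<le> \<rho>" "2 * (d + L) \<le> \<rho>" and "L > 0"
    and net: "\<And>u. norm u = 1 \<Longrightarrow> \<exists>s\<in>S. dist u s \<le> 1 / 8"
  shows "\<exists>s\<in>S. cnt \<xi> (box_at (\<rho> *\<^sub>R s) (\<rho> / (4 * d))) = 0 \<and>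
           separated L unit_cube (cell z) (box_at (\<rho> *\<^sub>R s) (\<rho> / (4 * d)))"
proof -
  have d: "d \<ge> 1" unfolding d_def using DIM_positive[where 'a='a] by linarith
  then have \<rho>0: "\<rho> > 0" using \<rho> by linarith
  obtain u where u: "norm u = 1" "\<And>v. v \<in> tau x \<xi> \<Longrightarrow> \<rho> \<le> dist v (\<rho> *\<^sub>R u)"
    using empty_tangent_ball[OF adj] \<rho>0 \<rho> by (metis less_eq_real_def)
  obtain s where s: "s \<in> S" "dist u s \<le> 1 / 8" using net u by blast
  let ?B = "box_at (\<rho> *\<^sub>R s) (\<rho> / (4 * d))"
  have "dist (x + \<rho> *\<^sub>R u) (\<rho> *\<^sub>R s) \<le> norm x + \<rho> * dist u s"
    using norm_triangle_ineq[of x "\<rho> *\<^sub>R u - \<rho> *\<^sub>R s"] norm_scaleR[of \<rho> "u - s"] \<rho>0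
    by (simp add: dist_norm scaleR_diff_right add_diff_eq)
  also have "norm x \<le> d"
    using dist_cell_le[of x 0 0] x by (simp add: unit_cube_eq_cell mem_cell d_def)
  also have "\<rho> * dist u s \<le> \<rho> / 8" using mult_left_mono[OF s(2), of \<rho>] \<rho>0 by simp
  finally have cen: "dist (x + \<rho> *\<^sub>R u) (\<rho> *\<^sub>R s) \<le> \<rho> / 4" using \<rho> by simp
  have near: "dist (x + \<rho> *\<^sub>R u) p \<le> \<rho> / 2" if "p \<in> ?B" for p
  proof -
    have "norm (p - \<rho> *\<^sub>R s) \<le> d * (\<rho> / (4 * d))"
      unfolding d_def by (rule norm_le_DIM) (use that in \<open>auto simp: mem_box_at d_def\<close>)
    then have "dist (\<rho> *\<^sub>R s) p \<le> \<rho> / 4" using d by (simp add: dist_norm norm_minus_commute)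
    then show ?thesis using cen dist_triangle[of "x + \<rho> *\<^sub>R u" p "\<rho> *\<^sub>R s"] by linarith
  qed
  have far: "\<rho> / 2 \<le> dist v p" if "v \<in> \<xi>" "p \<in> ?B" for v p
  proof -
    have "\<rho> \<le> dist (v - x) (\<rho> *\<^sub>R u)" using that by (intro u(2)) (auto simp: tau_def)
    also have "\<dots> = dist v (x + \<rho> *\<^sub>R u)" by (simp add: dist_norm algebra_simps)
    finally show ?thesis using near[OF that(2)] dist_triangle[of v "x + \<rho> *\<^sub>R u" p]
      by (simp add: dist_commute)
  qed
  have "cnt \<xi> ?B = 0"
    using far \<rho>0 unfolding cnt_def by (fastforce simp: disjoint_iff card_eq_0_iff)
  moreover have "separated L unit_cube (cell z) ?B"
  proof -
    have xi: "x \<in> \<xi>" "x + w \<in> \<xi>" using adj by (auto simp: dt_adj_def tau_def)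
    \<comment> \<open>Each cube contains an end point of the edge, so all its points are within
      \<open>d\<close> of \<open>\<xi>\<close>. This costs \<open>d\<close> out of the distance
      \<open>\<rho> / 2\<close>, and \<open>d + L \<le> \<rho> / 2\<close>.\<close>
    have L: "L \<le> dist a p" if "p \<in> ?B" "v \<in> \<xi>" "dist a v \<le> d" for a v p
      using far[OF that(2,1)] that(3) \<rho> dist_triangle[of v p a] by (simp add: dist_commute)
    \<comment> \<open>Cubes that meet would force \<open>norm w \<le> 2 * d\<close>, against
      \<open>4 * (d + L) \<le> norm w\<close>.\<close>
    have "a \<noteq> b" if "a \<in> unit_cube" "b \<in> cell z" for a b
    proof
      assume "a = b"
      then have "dist x (x + w) \<le> 2 * d"
        using dist_cell_le[of x 0 a] dist_cell_le[of b z "x + w"] x y that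
          dist_triangle[of x "x + w" a] by (simp add: d_def unit_cube_eq_cell)
      then show False using \<rho> d \<open>L > 0\<close> by (simp add: dist_norm)
    qed
    then show ?thesis unfolding separated_def
      using L xi dist_cell_le x y unfolding d_def unit_cube_eq_cell by blast
  qed
  ultimately show ?thesis using s(1) by blast
qed

text \<open>The sphere is compact, hence totally bounded. One net serves all scales, so the number
  of boxes per shell and cell stays bounded.\<close>

lemma finite_sphere_net:
  obtains S :: "'a::euclidean_space set"
  where "finite S" "\<And>u. norm u = 1 \<Longrightarrow> \<exists>s\<in>S. dist u s \<le> 1 / 8"
proof -
  have "\<exists>S. finite S \<and> S \<subseteq> sphere 0 1 \<and> sphere (0::'a) 1 \<subseteq> (\<Union>x\<in>S. ball x (1/8))"
    using seq_compact_imp_totally_bounded[of "sphere (0::'a) 1"] compact_sphere[of "0::'a" 1]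
    by (auto simp: compact_eq_seq_compact_metric)
  then obtain S where "finite S" "sphere (0::'a) 1 \<subseteq> (\<Union>x\<in>S. ball x (1/8))" by blast
  then show thesis using that[of S] by (force simp: dist_commute)
qed

section \<open>Pair counts, void indicators and the pathwise bound on the edge sum\<close>

definition pair_count :: "'a::euclidean_space \<Rightarrow> 'a set \<Rightarrow> ennreal" where
  "pair_count z \<xi> = ennreal (real (cnt \<xi> unit_cube * cnt \<xi> (cell z)))"

definition void :: "'a::euclidean_space set \<Rightarrow> 'a set \<Rightarrow> ennreal" where
  "void V \<xi> = (if cnt \<xi> V = 0 then 1 else 0)"

lemma bounded_boxes [simp]: "bounded (cell z)" "bounded (box_at b l)" "bounded (Lam l)" "bounded unit_cube"
  by (simp_all add: cell_def box_at_def Lam_def unit_cube_def)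

lemma borel_boxes [simp, measurable]:
  "cell z \<in> sets borel" "box_at b l \<in> sets borel" "Lam l \<in> sets borel" "unit_cube \<in> sets borel"
  by (simp_all add: cell_def box_at_def Lam_def unit_cube_def)

lemma sets_NN_cnt:
  assumes "A \<in> sets borel" "bounded A"
  shows "{\<xi>. locfin \<xi> \<and> cnt \<xi> A = k} \<in> sets NN"
proof -
  have "{{\<xi>. locfin \<xi> \<and> cnt \<xi> A = k} | A k. A \<in> sets borel \<and> bounded A} \<subseteq> Pow {\<xi>. locfin \<xi>}"
    by auto
  then show ?thesis using assms unfolding NN_def by (subst sets_measure_of) auto
qed

lemma space_NN: "space NN = {\<xi>. locfin \<xi>}"
  by (simp add: NN_def space_measure_of_conv)

lemma measurable_cnt [measurable (raw)]:
  assumes "A \<in> sets borel" "bounded A"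
  shows "(\<lambda>\<xi>. cnt \<xi> A) \<in> NN \<rightarrow>\<^sub>M count_space UNIV"
proof -
  have "(\<lambda>\<xi>. cnt \<xi> A) -` {k} \<inter> space NN \<in> sets NN" for k
    using sets_NN_cnt[OF assms, of k] by (simp add: space_NN vimage_def Int_def conj_commute)
  then show ?thesis by (simp add: measurable_count_space_eq2_countable)
qed

lemma measurable_pair_count [measurable]: "pair_count z \<in> borel_measurable NN"
  unfolding pair_count_def by measurable

lemma measurable_void [measurable (raw)]:
  "V \<in> sets borel \<Longrightarrow> bounded V \<Longrightarrow> void V \<in> borel_measurable NN"
  unfolding void_def
  using measurable_compose[OF measurable_cnt, of V "\<lambda>n. if n = 0 then 1 else 0 :: ennreal" borel] by simp

text \<open>For \<open>k < k0\<close> the boxes are too small to be separated from the cubes, and the trivial bound \<open>1\<close> is used.\<close>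

definition shell_void :: "real \<Rightarrow> nat \<Rightarrow> 'a::euclidean_space set \<Rightarrow> nat \<Rightarrow> 'a \<Rightarrow> 'a set \<Rightarrow> ennreal" where
  "shell_void L k0 S k z \<xi> = (if k < k0 then 1 else
     (\<Sum>s\<in>S. let V = box_at ((2 ^ k / 2) *\<^sub>R s) (2 ^ k / (8 * real DIM('a))) in
        if separated L unit_cube (cell z) V then void V \<xi> else 0))"

lemma measurable_shell_void [measurable]: "shell_void L k0 S k z \<in> borel_measurable NN"
  unfolding shell_void_def Let_def by measurable

text \<open>An edge \<open>w\<close> is charged to the least \<open>k\<close> with
  \<open>norm w \<le> 2 ^ (k + 1)\<close> and to a lattice cell containing \<open>x + w\<close>.
  There its weight is at most \<open>(2 ^ (k + 1)) powr \<zeta>\<close>, and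
  \<open>shell_void\<close> is at least \<open>1\<close>, by \<open>empty_box_near_edge\<close> with
  radius \<open>2 ^ k / 2\<close> unless \<open>k < k0\<close>. Summing over \<open>w\<close> counts
  the points of the cell; summing over \<open>x\<close> supplies the other factor of
  \<open>pair_count\<close>.\<close>

lemma edge_sum_le:
  fixes \<xi> S :: "'a::euclidean_space set"
  defines "d \<equiv> real DIM('a)"
  assumes \<xi>: "locfin \<xi>" and "\<zeta> \<ge> 0" and "L > 0" and S: "finite S"
    and net: "\<And>u. norm u = 1 \<Longrightarrow> \<exists>s\<in>S. dist u s \<le> 1 / 8"
    and k0: "8 * d \<le> 2 ^ k0 / 2" "2 * (d + L) \<le> 2 ^ k0 / 2"
  shows "(\<Sum>x\<in>\<xi> \<inter> unit_cube. \<integral>\<^sup>+w. indicator {w. dt_adj (tau x \<xi>) w 0} w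
            * ennreal (norm w powr \<zeta>) \<partial>count_space UNIV)
       \<le> (\<Sum>k. \<Sum>z\<in>lattice_pts (2 ^ (k + 2)). ennreal ((2 ^ (k + 1)) powr \<zeta>)
            * (pair_count z \<xi> * shell_void L k0 S k z \<xi>))"
proof -
  define c where "c k = ennreal ((2 ^ (k + 1)) powr \<zeta>)" for k :: nat
  have pointwise: "indicator {w. dt_adj (tau x \<xi>) w 0} w * ennreal (norm w powr \<zeta>)
      \<le> (\<Sum>k. \<Sum>z\<in>lattice_pts (2 ^ (k + 2)). c k * shell_void L k0 S k z \<xi>
            * indicator (tau x (\<xi> \<inter> cell z)) w)" (is "?l \<le> (\<Sum>k. ?t k)")
    if x: "x \<in> unit_cube" for x w
  proof (cases "dt_adj (tau x \<xi>) w 0")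
    case adj: True
    have "\<exists>k. norm w \<le> 2 ^ (k + 1)"
    proof -
      obtain n where "norm w < 2 ^ n" using real_arch_pow[of 2 "norm w"] by auto
      moreover have "(2::real) ^ n \<le> 2 ^ (n + 1)" by simp
      ultimately show ?thesis by (meson less_imp_le order_trans)
    qed
    then obtain k where k: "norm w \<le> 2 ^ (k + 1)" "\<And>j. j < k \<Longrightarrow> 2 ^ (j + 1) < norm w"
      using exists_least_iff[of "\<lambda>k. norm w \<le> 2 ^ (k + 1)"] by (auto simp: not_le)
    have "\<bar>(x + w) \<bullet> i\<bar> \<le> real (2 ^ (k + 2))" if i: "i \<in> Basis" for i
    proof -
      have "0 \<le> x \<bullet> i" "x \<bullet> i \<le> 1" using x i by (auto simp: unit_cube_eq_cell mem_cell)
      moreover have "\<bar>w \<bullet> i\<bar> \<le> 2 ^ (k + 1)" using Basis_le_norm[OF i, of w] k by linarith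
      moreover have "(1::real) \<le> 2 ^ (k + 1)" by (rule one_le_power) simp
      ultimately show ?thesis by (simp add: inner_simps abs_le_iff)
    qed
    then obtain z where z: "z \<in> lattice_pts (2 ^ (k + 2))" "x + w \<in> cell z"
      by (rule lattice_cell_cover)
    have "1 \<le> shell_void L k0 S k z \<xi>"
    proof (cases "k < k0")
      case True
      then show ?thesis by (simp add: shell_void_def)
    next
      case False
      \<comment> \<open>\<open>k0 = 0\<close> is excluded by \<open>8 * d \<le> 2 ^ k0 / 2\<close>,
        so \<open>k > 0\<close>, and minimality of \<open>k\<close> at \<open>j\<close> gives
        \<open>2 ^ k < norm w\<close>, the lower bound required for the radius
        \<open>2 ^ k / 2\<close>.\<close>
      then obtain j where j: "k = Suc j" using k0 d_def DIM_positive[where 'a='a]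
        by (cases k) (auto simp: not_less)
      have pw: "(2::real) ^ k0 \<le> 2 ^ k" using False by (intro power_increasing) auto
      have "\<exists>s\<in>S. cnt \<xi> (box_at ((2 ^ k / 2) *\<^sub>R s) (2 ^ k / 2 / (4 * d))) = 0 \<and>
           separated L unit_cube (cell z) (box_at ((2 ^ k / 2) *\<^sub>R s) (2 ^ k / 2 / (4 * d)))"
        unfolding d_def
        by (rule empty_box_near_edge[OF adj x z(2) _ _ _ \<open>L > 0\<close> net])
          (use pw k0 k(2)[of j] j in \<open>auto simp: d_def\<close>)
      then obtain s where s: "s \<in> S" "cnt \<xi> (box_at ((2 ^ k / 2) *\<^sub>R s) (2 ^ k / (8 * d))) = 0"
        "separated L unit_cube (cell z) (box_at ((2 ^ k / 2) *\<^sub>R s) (2 ^ k / (8 * d)))"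
        by (auto simp: field_simps)
      let ?f = "\<lambda>s. let V = box_at ((2 ^ k / 2) *\<^sub>R s) (2 ^ k / (8 * real DIM('a))) in
        if separated L unit_cube (cell z) V then void V \<xi> else 0"
      have "1 = ?f s" using s by (simp add: void_def d_def Let_def)
      also have "\<dots> \<le> sum ?f S" using s(1) S by (intro member_le_sum) auto
      finally show ?thesis using False by (simp add: shell_void_def)
    qed
    have "?l \<le> c k * 1 * 1"
      using k(1) \<open>\<zeta> \<ge> 0\<close> adj by (auto simp: c_def intro!: ennreal_leI powr_mono2)
    also have "\<dots> \<le> c k * shell_void L k0 S k z \<xi> * indicator (tau x (\<xi> \<inter> cell z)) w"
    proof -
      have "w \<in> tau x (\<xi> \<inter> cell z)" using adj z(2)
        by (auto simp: dt_adj_def tau_def image_iff intro!: bexI[of _ "x + w"])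
      then show ?thesis using \<open>1 \<le> shell_void L k0 S k z \<xi>\<close>
          mult_left_mono[of 1 "shell_void L k0 S k z \<xi>" "c k"] by simp
    qed
    also have "\<dots> \<le> ?t k" using z(1) by (intro member_le_sum) auto
    also have "\<dots> \<le> (\<Sum>k. ?t k)" using sum_le_suminf[of ?t "{k}"] by simp
    finally show ?thesis .
  qed simp
  \<comment> \<open>Integrating over \<open>w\<close> turns the indicator of a translated cell into
    its number of points, so the bound no longer depends on \<open>x\<close>.\<close>
  have inner: "(\<integral>\<^sup>+w. indicator {w. dt_adj (tau x \<xi>) w 0} w
            * ennreal (norm w powr \<zeta>) \<partial>count_space UNIV)
      \<le> (\<Sum>k. \<Sum>z\<in>lattice_pts (2 ^ (k + 2)). c k * shell_void L k0 S k z \<xi> * of_nat (cnt \<xi> (cell z)))"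
    if x: "x \<in> unit_cube" for x
  proof -
    have card: "(\<integral>\<^sup>+w. indicator (tau x (\<xi> \<inter> cell z)) w \<partial>count_space UNIV) = of_nat (cnt \<xi> (cell z))" for z
    proof -
      have "card (tau x (\<xi> \<inter> cell z)) = cnt \<xi> (cell z)"
        unfolding tau_def cnt_def by (rule card_image) (simp add: inj_on_def)
      moreover have "finite (tau x (\<xi> \<inter> cell z))" using \<xi> by (simp add: tau_def locfin_finite)
      ultimately show ?thesis by simp
    qed
    have "(\<integral>\<^sup>+w. indicator {w. dt_adj (tau x \<xi>) w 0} w
            * ennreal (norm w powr \<zeta>) \<partial>count_space UNIV)
      \<le> (\<integral>\<^sup>+w. (\<Sum>k. \<Sum>z\<in>lattice_pts (2 ^ (k + 2)). c k * shell_void L k0 S k z \<xi>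
            * indicator (tau x (\<xi> \<inter> cell z)) w) \<partial>count_space UNIV)"
      by (intro nn_integral_mono pointwise x)
    also have "\<dots> = (\<Sum>k. \<Sum>z\<in>lattice_pts (2 ^ (k + 2)). c k * shell_void L k0 S k z \<xi> * of_nat (cnt \<xi> (cell z)))"
      by (simp only: nn_integral_suminf nn_integral_sum nn_integral_cmult card
          borel_measurable_count_space)
    finally show ?thesis .
  qed
  have "(\<Sum>x\<in>\<xi> \<inter> unit_cube. \<integral>\<^sup>+w. indicator {w. dt_adj (tau x \<xi>) w 0} w
            * ennreal (norm w powr \<zeta>) \<partial>count_space UNIV)
     \<le> of_nat (cnt \<xi> unit_cube) * (\<Sum>k. \<Sum>z\<in>lattice_pts (2 ^ (k + 2)). c k * shell_void L k0 S k z \<xi> * of_nat (cnt \<xi> (cell z)))"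
    unfolding cnt_def[of \<xi> unit_cube] by (rule sum_bounded_above) (use inner in auto)
  also have "\<dots> = (\<Sum>k. \<Sum>z\<in>lattice_pts (2 ^ (k + 2)). c k * (pair_count z \<xi> * shell_void L k0 S k z \<xi>))"
    by (simp add: pair_count_def sum_distrib_left mult_ac ennreal_of_nat_eq_real_of_nat ennreal_mult
        flip: ennreal_suminf_cmult)
  finally show ?thesis by (simp add: c_def)
qed

section \<open>Stationary processes\<close>

text \<open>Stationarity enters through functions of a single count: void probabilities of boxes and
  moments of cell counts have this form.\<close>

locale stationary_process = prob_space P for P :: "'a::euclidean_space set measure" +
  assumes sets_P [measurable_cong]: "sets P = sets NN"
    and shift: "\<And>(f :: nat \<Rightarrow> ennreal) A z. A \<in> sets borel \<Longrightarrow> bounded A \<Longrightarrow>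
      (\<integral>\<^sup>+\<xi>. f (cnt \<xi> ((+) z ` A)) \<partial>P) = (\<integral>\<^sup>+\<xi>. f (cnt \<xi> A) \<partial>P)"
begin

lemma space_P: "space P = {\<xi>. locfin \<xi>}"
  using sets_eq_imp_space_eq[OF sets_P] by (simp add: space_NN)

lemma measurable_cnt_P [measurable (raw)]:
  "A \<in> sets borel \<Longrightarrow> bounded A \<Longrightarrow> (\<lambda>\<xi>. cnt \<xi> A) \<in> P \<rightarrow>\<^sub>M count_space UNIV"
  using measurable_cnt[of A] measurable_cong_sets[OF sets_P refl] by blast

definition void_prob :: "real \<Rightarrow> real" where
  "void_prob l = measure P {\<xi>\<in>space P. cnt \<xi> (Lam l) = 0}"

lemma nn_integral_void:
  assumes "V \<in> sets borel" "bounded V"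
  shows "(\<integral>\<^sup>+\<xi>. void V \<xi> \<partial>P) = ennreal (measure P {\<xi>\<in>space P. cnt \<xi> V = 0})"
proof -
  have [measurable]: "(\<lambda>\<xi>. cnt \<xi> V) \<in> P \<rightarrow>\<^sub>M count_space UNIV" using assms by (rule measurable_cnt_P)
  have "(\<integral>\<^sup>+\<xi>. void V \<xi> \<partial>P) = (\<integral>\<^sup>+\<xi>. indicator {\<xi>\<in>space P. cnt \<xi> V = 0} \<xi> \<partial>P)"
    by (intro nn_integral_cong) (auto simp: void_def indicator_def)
  also have "\<dots> = emeasure P {\<xi>\<in>space P. cnt \<xi> V = 0}" by (intro nn_integral_indicator) measurable
  finally show ?thesis by (simp add: emeasure_eq_measure)
qed

lemma nn_integral_void_box: "(\<integral>\<^sup>+\<xi>. void (box_at b l) \<xi> \<partial>P) = ennreal (void_prob l)"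
proof -
  have "(\<integral>\<^sup>+\<xi>. void (box_at b l) \<xi> \<partial>P) = (\<integral>\<^sup>+\<xi>. void (Lam l) \<xi> \<partial>P)"
    unfolding box_at_translate void_def by (rule shift) auto
  then show ?thesis by (simp add: nn_integral_void void_prob_def)
qed

lemma measure_void_box: "measure P {\<xi>\<in>space P. cnt \<xi> (box_at b l) = 0} = void_prob l"
  using nn_integral_void_box[of b l] nn_integral_void[of "box_at b l"]
  by (simp add: void_prob_def)

text \<open>By \<open>2 * a * b \<le> a^2 + b^2\<close>, the mixed moment is at most the mean of the
  two moments of order \<open>2 * p\<close>, which agree by stationarity.\<close>

lemma cross_moment_le:
  assumes "0 \<le> p"
  shows "(\<integral>\<^sup>+\<xi>. ennreal (real (cnt \<xi> unit_cube * cnt \<xi> (cell z)) powr p) \<partial>P) \<le> rho P (2 * p)"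
proof -
  let ?g = "\<lambda>A \<xi>. ennreal (real (cnt \<xi> A) powr (2 * p))"
  have meas [measurable]: "?g (cell z) \<in> borel_measurable P" for z
    by (rule measurable_compose[OF measurable_cnt_P]) auto
  have "(\<integral>\<^sup>+\<xi>. ennreal (real (cnt \<xi> unit_cube * cnt \<xi> (cell z)) powr p) \<partial>P)
    \<le> (\<integral>\<^sup>+\<xi>. ennreal (1 / 2) * ?g (cell 0) \<xi> + ennreal (1 / 2) * ?g (cell z) \<xi> \<partial>P)"
  proof (rule nn_integral_mono)
    fix \<xi> :: "'a set"
    define a b where "a = real (cnt \<xi> unit_cube) powr p" and "b = real (cnt \<xi> (cell z)) powr p"
    have "2 * (a * b) \<le> a\<^sup>2 + b\<^sup>2" using sum_squares_bound[of a b] by simp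
    moreover have "a\<^sup>2 = real (cnt \<xi> unit_cube) powr (2 * p)" "b\<^sup>2 = real (cnt \<xi> (cell z)) powr (2 * p)"
      by (simp_all add: a_def b_def power2_eq_square flip: powr_add)
    moreover have "real (cnt \<xi> unit_cube * cnt \<xi> (cell z)) powr p = a * b"
      by (simp add: a_def b_def powr_mult)
    ultimately have "ennreal (real (cnt \<xi> unit_cube * cnt \<xi> (cell z)) powr p)
      \<le> ennreal (1 / 2 * real (cnt \<xi> unit_cube) powr (2 * p) + 1 / 2 * real (cnt \<xi> (cell z)) powr (2 * p))"
      by (intro ennreal_leI) simp
    moreover have half: "ennreal (1 / 2) * ennreal x = ennreal (x / 2)" for x
      using ennreal_mult'[of "1 / 2" x] by simp
    ultimately show "ennreal (real (cnt \<xi> unit_cube * cnt \<xi> (cell z)) powr p)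
      \<le> ennreal (1 / 2) * ?g (cell 0) \<xi> + ennreal (1 / 2) * ?g (cell z) \<xi>"
      by (simp add: unit_cube_eq_cell[symmetric] half ennreal_plus del: ennreal_half)
  qed
  also have "\<dots> = ennreal (1 / 2) * (\<integral>\<^sup>+\<xi>. ?g (cell 0) \<xi> \<partial>P) + ennreal (1 / 2) * (\<integral>\<^sup>+\<xi>. ?g (cell z) \<xi> \<partial>P)"
    by (simp add: nn_integral_add nn_integral_cmult)
  also have "(\<integral>\<^sup>+\<xi>. ?g (cell z) \<xi> \<partial>P) = rho P (2 * p)"
    unfolding rho_def cell_translate by (rule shift) auto
  also have "(\<integral>\<^sup>+\<xi>. ?g (cell 0) \<xi> \<partial>P) = rho P (2 * p)"
    by (simp add: rho_def unit_cube_eq_cell)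
  also have "ennreal (1 / 2) * rho P (2 * p) + ennreal (1 / 2) * rho P (2 * p) = rho P (2 * p)"
  proof -
    have "ennreal (1 / 2) + ennreal (1 / 2) = 1" by (subst ennreal_plus[symmetric]) auto
    then show ?thesis by (simp only: distrib_right[symmetric] mult_1_left)
  qed
  finally show ?thesis .
qed

lemma pair_count_le: "(\<integral>\<^sup>+\<xi>. pair_count z \<xi> \<partial>P) \<le> rho P 2"
  using cross_moment_le[of 1 z] by (simp add: pair_count_def)

text \<open>Counts are integers: powers of a count at least \<open>1\<close> increase with the
  exponent, and for count \<open>0\<close> both powers are \<open>0\<close>.\<close>

lemma rho_mono:
  assumes "0 < a" "a \<le> b"
  shows "rho P a \<le> rho P b"
  unfolding rho_def
proof (intro nn_integral_mono ennreal_leI)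
  fix \<xi> :: "'a set"
  show "real (cnt \<xi> unit_cube) powr a \<le> real (cnt \<xi> unit_cube) powr b"
    using assms by (cases "cnt \<xi> unit_cube = 0") (auto intro!: powr_mono)
qed

section \<open>Summation of the expected edge weights over the shells\<close>

text \<open>Shell \<open>k\<close> has at most \<open>(16 * 2 ^ k) ^ DIM('a)\<close> cells, each of
  weight \<open>(2 ^ (k + 1)) powr \<zeta>\<close> and expectation at most
  \<open>D * (2 ^ k) powr - \<beta>\<close>. The shell sums are therefore geometric with ratio
  \<open>q = 2 powr (d + \<zeta> - \<beta>)\<close>, which is below \<open>1\<close>.\<close>

lemma edge_sum_finite:
  fixes L K \<beta> \<zeta> :: real
  assumes "L > 0" "K \<ge> 0" "\<zeta> \<ge> 0" and \<beta>: "real DIM('a) + \<zeta> < \<beta>" and rho2: "rho P 2 < \<infinity>"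
    and decay: "\<And>l b z. 1 \<le> l \<Longrightarrow> separated L unit_cube (cell z) (box_at b l) \<Longrightarrow>
      (\<integral>\<^sup>+\<xi>. pair_count z \<xi> * void (box_at b l) \<xi> \<partial>P) \<le> ennreal (K * l powr - \<beta>)"
  shows "(\<integral>\<^sup>+\<xi>. (\<Sum>x\<in>\<xi> \<inter> unit_cube. \<integral>\<^sup>+w. indicator {w. dt_adj (tau x \<xi>) w 0} w
            * ennreal (norm w powr \<zeta>) \<partial>count_space UNIV) \<partial>P) < \<infinity>"
proof -
  define d where "d = real DIM('a)"
  have d: "d \<ge> 1" unfolding d_def using DIM_positive[where 'a='a] by linarith
  obtain S :: "'a set" where S: "finite S" "\<And>u. norm u = 1 \<Longrightarrow> \<exists>s\<in>S. dist u s \<le> 1 / 8"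
    using finite_sphere_net by blast
  \<comment> \<open>This covers both size conditions of \<open>edge_sum_le\<close> and makes the
    half-side \<open>2 ^ k / (8 * d)\<close> at least \<open>1\<close> for
    \<open>k \<ge> k0\<close>, as \<open>decay\<close> requires.\<close>
  obtain k0 where k0: "2 * (8 * d + 2 * (d + L)) < 2 ^ k0"
    using real_arch_pow[of 2] by auto
  obtain r2 where r2: "rho P 2 = ennreal r2" "r2 \<ge> 0"
    using rho2 by (cases "rho P 2") auto
  have meas [measurable]: "pair_count z \<in> borel_measurable P"
      "shell_void L k0 S k z \<in> borel_measurable P" "void (box_at b l) \<in> borel_measurable P" for z k b l
    using measurable_cong_sets[OF sets_P refl] measurable_pair_count measurable_shell_void
      measurable_void[of "box_at b l"] by auto
  \<comment> \<open>The first summand absorbs the shells below \<open>k0\<close>, where only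
    \<open>rho P 2\<close> is available; the second collects the \<open>card S\<close> boxes of
    half-side \<open>2 ^ k / (8 * d)\<close>.\<close>
  define D where "D = r2 * (2 ^ k0) powr \<beta> + real (card S) * (K * (8 * d) powr \<beta>)"
  have D: "D \<ge> 0" unfolding D_def using r2 \<open>K \<ge> 0\<close> by auto
  have shell: "(\<integral>\<^sup>+\<xi>. pair_count z \<xi> * shell_void L k0 S k z \<xi> \<partial>P) \<le> ennreal (D * (2 ^ k) powr - \<beta>)" for k z
  proof (cases "k < k0")
    case True
    have "(\<integral>\<^sup>+\<xi>. pair_count z \<xi> * shell_void L k0 S k z \<xi> \<partial>P) \<le> ennreal r2"
      using True pair_count_le[of z] r2 by (simp add: shell_void_def)
    also have "r2 * 1 \<le> r2 * ((2 ^ k0) powr \<beta> * (2 ^ k) powr - \<beta>)"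
    proof (intro mult_left_mono)
      have "(2 ^ k) powr \<beta> \<le> ((2::real) ^ k0) powr \<beta>"
        using True \<beta> d_def d \<open>\<zeta> \<ge> 0\<close> by (intro powr_mono2) auto
      then show "1 \<le> (2 ^ k0) powr \<beta> * ((2::real) ^ k) powr - \<beta>" by (simp add: powr_minus field_simps)
    qed (use r2 in auto)
    then have "ennreal r2 \<le> ennreal (D * (2 ^ k) powr - \<beta>)"
      using \<open>K \<ge> 0\<close> by (intro ennreal_leI) (simp add: D_def algebra_simps add_increasing2)
    finally show ?thesis .
  next
    case False
    then have pw: "(2::real) ^ k0 \<le> 2 ^ k" by (intro power_increasing) auto
    define l where "l = 2 ^ k / (8 * d)"
    have l: "1 \<le> l" proof -
      have "8 * d \<le> 2 * (8 * d + 2 * (d + L))" using d \<open>L > 0\<close> by simp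
      also have "\<dots> \<le> 2 ^ k" using k0 pw by (meson less_imp_le order_trans)
      finally have "8 * d \<le> 2 ^ k" .
      then show ?thesis using d by (simp add: l_def)
    qed
    have "(\<integral>\<^sup>+\<xi>. pair_count z \<xi> * shell_void L k0 S k z \<xi> \<partial>P) =
      (\<Sum>s\<in>S. \<integral>\<^sup>+\<xi>. pair_count z \<xi> * (let V = box_at ((2 ^ k / 2) *\<^sub>R s) l in
        if separated L unit_cube (cell z) V then void V \<xi> else 0) \<partial>P)"
      using False by (subst nn_integral_sum[symmetric])
        (auto simp: shell_void_def l_def d_def sum_distrib_left Let_def)
    also have "\<dots> \<le> (\<Sum>s\<in>S. ennreal (K * l powr - \<beta>))"
      proof (intro sum_mono)
      fix s assume "s \<in> S"
      show "(\<integral>\<^sup>+\<xi>. pair_count z \<xi> * (let V = box_at ((2 ^ k / 2) *\<^sub>R s) l in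
        if separated L unit_cube (cell z) V then void V \<xi> else 0) \<partial>P) \<le> ennreal (K * l powr - \<beta>)"
        using decay[OF l] by (cases "separated L unit_cube (cell z) (box_at ((2 ^ k / 2) *\<^sub>R s) l)")
          (simp_all add: Let_def)
    qed
    also have "\<dots> = ennreal (real (card S) * (K * l powr - \<beta>))"
      using \<open>K \<ge> 0\<close> by (simp add: ennreal_of_nat_eq_real_of_nat ennreal_mult)
    also have "l powr - \<beta> = (8 * d) powr \<beta> * (2 ^ k) powr - \<beta>"
      using d by (simp add: l_def powr_divide powr_minus field_simps)
    also have "ennreal (real (card S) * (K * ((8 * d) powr \<beta> * (2 ^ k) powr - \<beta>)))
       \<le> ennreal (D * (2 ^ k) powr - \<beta>)"
      using r2 by (intro ennreal_leI) (simp add: D_def algebra_simps)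
    finally show ?thesis .
  qed
  define q where "q = 2 powr (d + \<zeta> - \<beta>)"
  define C where "C = 2 powr \<zeta> * 16 ^ DIM('a) * D"
  have q: "0 \<le> q" "q < 1" using \<beta> by (auto simp: q_def d_def powr_less_one)
  have shell_sum: "(\<Sum>z\<in>(lattice_pts (2 ^ (k + 2)) :: 'a set). ennreal ((2 ^ (k + 1)) powr \<zeta>)
            * (\<integral>\<^sup>+\<xi>. pair_count z \<xi> * shell_void L k0 S k z \<xi> \<partial>P)) \<le> ennreal (C * q ^ k)" for k
  proof -
    let ?b = "(2 ^ (k + 1)) powr \<zeta> * (D * (2 ^ k) powr - \<beta>) :: real"
    have "(\<Sum>z\<in>(lattice_pts (2 ^ (k + 2)) :: 'a set). ennreal ((2 ^ (k + 1)) powr \<zeta>)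
            * (\<integral>\<^sup>+\<xi>. pair_count z \<xi> * shell_void L k0 S k z \<xi> \<partial>P))
      \<le> (\<Sum>z\<in>(lattice_pts (2 ^ (k + 2)) :: 'a set). ennreal ?b)"
      using shell by (intro sum_mono) (simp add: ennreal_mult D mult_left_mono)
    also have "\<dots> = ennreal (real (card (lattice_pts (2 ^ (k + 2)) :: 'a set)) * ?b)"
      using D by (simp add: ennreal_of_nat_eq_real_of_nat ennreal_mult)
    \<comment> \<open>Here \<open>2 * 2 ^ (k + 2) + 1 = 8 * 2 ^ k + 1\<close>, and \<open>16\<close>
      leaves room for the \<open>+ 1\<close>.\<close>
    also have "\<dots> \<le> ennreal ((16 * 2 ^ k) ^ DIM('a) * ?b)"
    proof (intro ennreal_leI mult_right_mono)
      have "card (lattice_pts (2 ^ (k + 2)) :: 'a set) \<le> (2 * 2 ^ (k + 2) + 1) ^ DIM('a)"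
        by (rule card_lattice_pts)
      also have "\<dots> \<le> (16 * 2 ^ k) ^ DIM('a)"
        using one_le_power[of "2::nat" k] by (intro power_mono) (simp_all add: power_add)
      finally have "real (card (lattice_pts (2 ^ (k + 2)) :: 'a set)) \<le> real ((16 * 2 ^ k) ^ DIM('a))"
        by (rule of_nat_mono)
      then show "real (card (lattice_pts (2 ^ (k + 2)) :: 'a set)) \<le> (16 * 2 ^ k) ^ DIM('a)" by simp
    qed (use D in auto)
    also have "(16 * 2 ^ k) ^ DIM('a) * ?b = C * q ^ k"
    proof -
      have "q ^ k = 2 powr (d * k) * 2 powr (\<zeta> * k) * 2 powr (- \<beta> * k)"
        by (simp add: q_def powr_power algebra_simps flip: powr_add)
      moreover have "((2::real) ^ k) ^ DIM('a) = 2 powr (d * k)"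
        by (simp add: d_def powr_realpow[symmetric] powr_power powr_powr mult.commute)
      moreover have "((2::real) ^ k) powr - \<beta> = 2 powr (- \<beta> * k)"
        by (simp add: powr_realpow[symmetric] powr_powr mult.commute)
      moreover have "((2::real) ^ (k + 1)) powr \<zeta> = 2 powr \<zeta> * 2 powr (\<zeta> * k)"
        by (simp add: powr_realpow[symmetric] powr_powr powr_mult mult.commute)
      ultimately show ?thesis by (simp add: C_def power_mult_distrib)
    qed
    finally show ?thesis .
  qed
  have "(\<integral>\<^sup>+\<xi>. (\<Sum>x\<in>\<xi> \<inter> unit_cube. \<integral>\<^sup>+w. indicator {w. dt_adj (tau x \<xi>) w 0} w
            * ennreal (norm w powr \<zeta>) \<partial>count_space UNIV) \<partial>P)
    \<le> (\<integral>\<^sup>+\<xi>. (\<Sum>k. \<Sum>z\<in>lattice_pts (2 ^ (k + 2)). ennreal ((2 ^ (k + 1)) powr \<zeta>)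
            * (pair_count z \<xi> * shell_void L k0 S k z \<xi>)) \<partial>P)"
    using d \<open>L > 0\<close> k0 by (intro nn_integral_mono edge_sum_le[OF _ \<open>\<zeta> \<ge> 0\<close> \<open>L > 0\<close> S])
      (auto simp: space_P d_def)
  also have "\<dots> = (\<Sum>k. \<Sum>z\<in>(lattice_pts (2 ^ (k + 2)) :: 'a set). ennreal ((2 ^ (k + 1)) powr \<zeta>)
            * (\<integral>\<^sup>+\<xi>. pair_count z \<xi> * shell_void L k0 S k z \<xi> \<partial>P))"
    by (simp add: nn_integral_suminf nn_integral_sum nn_integral_cmult)
  also have "\<dots> \<le> (\<Sum>k. ennreal (C * q ^ k))"
    using shell_sum by (intro suminf_le) auto
  also have "\<dots> < \<infinity>"
  proof -
    have "summable (\<lambda>k. C * q ^ k)" using q by (intro summable_mult summable_geometric) auto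
    moreover have "0 \<le> C * q ^ k" for k using q D by (auto simp: C_def)
    ultimately show ?thesis by (subst suminf_ennreal2) auto
  qed
  finally show ?thesis .
qed

end

section \<open>Independence and locality of counts\<close>

lemma (in prob_space) indep_var_nn_integral:
  fixes f g :: "'b \<Rightarrow> ennreal"
  assumes indep: "indep_var M1 X M2 Y"
    and f: "f \<in> borel_measurable M1" and g: "g \<in> borel_measurable M2"
  shows "(\<integral>\<^sup>+\<omega>. f (X \<omega>) * g (Y \<omega>) \<partial>M) = (\<integral>\<^sup>+\<omega>. f (X \<omega>) \<partial>M) * (\<integral>\<^sup>+\<omega>. g (Y \<omega>) \<partial>M)"
proof -
  have "indep_var borel (f \<circ> X) borel (g \<circ> Y)" by (rule indep_var_compose[OF indep f g])
  moreover have "(case_bool borel borel :: bool \<Rightarrow> ennreal measure) = (\<lambda>_. borel)"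
    by (auto split: bool.split)
  ultimately have "indep_vars (\<lambda>_. borel) (case_bool (f \<circ> X) (g \<circ> Y)) UNIV"
    by (simp add: indep_var_def)
  from indep_vars_nn_integral[OF _ this] show ?thesis by (simp add: UNIV_bool mult.commute comp_def)
qed

lemma cnt_eq_0_subset:
  assumes "locfin \<xi>" "bounded B" "A \<subseteq> B" "cnt \<xi> B = 0"
  shows "cnt \<xi> A = 0"
  using assms bounded_subset[of B A] cnt_eq_0_iff[of \<xi> B] cnt_eq_0_iff[of \<xi> A] by blast

text \<open>This turns counts inside \<open>B\<close> into functions of the restricted
  configuration, the form in which finite range of dependence is stated.\<close>

lemma cnt_Int: "A \<subseteq> B \<Longrightarrow> cnt (\<xi> \<inter> B) A = cnt \<xi> A"
  unfolding cnt_def by (rule arg_cong[where f = card]) auto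

context stationary_process
begin

lemma measurable_pair_void_P [measurable]:
  "pair_count z \<in> borel_measurable P" "void (box_at b l) \<in> borel_measurable P"
  "void (Lam l) \<in> borel_measurable P"
  using measurable_cong_sets[OF sets_P refl] measurable_pair_count measurable_void by auto

lemma cond_C_iff: "cond_C P \<alpha> \<longleftrightarrow> (\<exists>\<kappa>>0. \<forall>l\<ge>1. void_prob l \<le> \<kappa> * l powr - \<alpha>)"
  by (simp add: cond_C_def void_prob_def)

section \<open>Decay under the three hypotheses\<close>

text \<open>Truncation plays the role of the Hoelder inequality with exponent
  \<open>p = \<gamma> / 2\<close>, for which the moment of order \<open>p\<close> of
  \<open>N_0 N_z\<close> is controlled by \<open>rho P \<gamma>\<close>. The exponent
  \<open>\<alpha>\<close> shrinks by the factor
  \<open>1 - 1 / p = (\<gamma> - 2) / \<gamma>\<close>.\<close>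

lemma decay_of_higher_moment:
  assumes "\<gamma> > 2" and rho: "rho P \<gamma> < \<infinity>" and "cond_C P \<alpha>"
  obtains K where "K \<ge> 0" "\<And>l b z. 1 \<le> l \<Longrightarrow>
      (\<integral>\<^sup>+\<xi>. pair_count z \<xi> * void (box_at b l) \<xi> \<partial>P) \<le> ennreal (K * l powr - (\<alpha> * (\<gamma> - 2) / \<gamma>))"
proof -
  define p where "p = \<gamma> / 2"
  have p: "p > 1" "\<gamma> = 2 * p" using assms by (auto simp: p_def)
  obtain r where r: "rho P \<gamma> = ennreal r" "r \<ge> 0" using rho by (cases "rho P \<gamma>") auto
  obtain \<kappa> where \<kappa>: "\<kappa> > 0" "\<And>l. l \<ge> 1 \<Longrightarrow> void_prob l \<le> \<kappa> * l powr - \<alpha>"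
    using \<open>cond_C P \<alpha>\<close> cond_C_iff by blast
  have "(\<integral>\<^sup>+\<xi>. pair_count z \<xi> * void (box_at b l) \<xi> \<partial>P) \<le> ennreal ((\<kappa> + r) * l powr - (\<alpha> * (\<gamma> - 2) / \<gamma>))"
    if l: "1 \<le> l" for l b z
  proof -
    \<comment> \<open>this level balances the two terms of \<open>X 1_A \<le> T 1_A + T^(1-p) X^p\<close>\<close>
    define T where "T = l powr (\<alpha> / p)"
    have T: "T > 0" using l by (simp add: T_def)
    let ?X = "\<lambda>\<xi>. real (cnt \<xi> unit_cube * cnt \<xi> (cell z))"
    have [measurable]: "(\<lambda>\<xi>. ennreal (?X \<xi> powr p)) \<in> borel_measurable P" by measurable
    have "(\<integral>\<^sup>+\<xi>. pair_count z \<xi> * void (box_at b l) \<xi> \<partial>P)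
      \<le> (\<integral>\<^sup>+\<xi>. ennreal T * void (box_at b l) \<xi> + ennreal (T powr (1 - p)) * ennreal (?X \<xi> powr p) \<partial>P)"
    proof (rule nn_integral_mono)
      fix \<xi> :: "'a set"
      \<comment> \<open>Since \<open>1 - p < 0\<close>, the factor
        \<open>?X \<xi> powr (1 - p)\<close> is at most \<open>T powr (1 - p)\<close> above the
        level \<open>T\<close>.\<close>
      have "?X \<xi> \<le> T powr (1 - p) * ?X \<xi> powr p" if "T < ?X \<xi>"
      proof -
        have "?X \<xi> = ?X \<xi> powr (1 - p) * ?X \<xi> powr p"
          using that T by (simp flip: powr_add)
        also have "\<dots> \<le> T powr (1 - p) * ?X \<xi> powr p"
          using that T p by (intro mult_right_mono powr_mono2') auto
        finally show ?thesis .
      qed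
      then have "?X \<xi> \<le> T + T powr (1 - p) * ?X \<xi> powr p"
        using T by (cases "T < ?X \<xi>") (auto simp: not_less add_increasing2 add_increasing)
      then have "pair_count z \<xi> \<le> ennreal T + ennreal (T powr (1 - p)) * ennreal (?X \<xi> powr p)"
        unfolding pair_count_def using T by (simp flip: ennreal_mult ennreal_plus)
      then show "pair_count z \<xi> * void (box_at b l) \<xi>
        \<le> ennreal T * void (box_at b l) \<xi> + ennreal (T powr (1 - p)) * ennreal (?X \<xi> powr p)"
        by (auto simp: void_def)
    qed
    also have "\<dots> = ennreal T * ennreal (void_prob l)
        + ennreal (T powr (1 - p)) * (\<integral>\<^sup>+\<xi>. ennreal (?X \<xi> powr p) \<partial>P)"
      by (simp add: nn_integral_add nn_integral_cmult nn_integral_void_box del: of_nat_mult)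
    also have "\<dots> \<le> ennreal T * ennreal (\<kappa> * l powr - \<alpha>) + ennreal (T powr (1 - p)) * ennreal r"
      using cross_moment_le[of p z] p r \<kappa>(2)[OF l]
      by (intro add_mono mult_left_mono ennreal_leI) auto
    also have "\<dots> = ennreal (T * (\<kappa> * l powr - \<alpha>) + T powr (1 - p) * r)"
      using T \<kappa>(1) r by (simp add: ennreal_mult ennreal_plus)
    also have "T * (\<kappa> * l powr - \<alpha>) + T powr (1 - p) * r = (\<kappa> + r) * l powr - (\<alpha> * (\<gamma> - 2) / \<gamma>)"
    proof -
      have "\<alpha> / p - \<alpha> = - (\<alpha> * (\<gamma> - 2) / \<gamma>)" "\<alpha> / p * (1 - p) = - (\<alpha> * (\<gamma> - 2) / \<gamma>)"
        using p by (simp_all add: field_simps)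
      then have "T * l powr - \<alpha> = l powr - (\<alpha> * (\<gamma> - 2) / \<gamma>)"
        "T powr (1 - p) = l powr - (\<alpha> * (\<gamma> - 2) / \<gamma>)"
        unfolding T_def by (simp_all only: powr_powr powr_add[symmetric] add_uminus_conv_diff)
      then show ?thesis by (simp add: algebra_simps)
    qed
    finally show ?thesis .
  qed
  then show thesis using that[of "\<kappa> + r"] \<kappa> r by simp
qed

text \<open>Common end of (H2) and (H3): each only has to supply the correlation inequality
  \<open>corr\<close>, and Condition C then gives the decay.\<close>

lemma decay_of_negative_correlation:
  assumes rho: "rho P 2 < \<infinity>" and "cond_C P \<alpha>"
    and corr: "\<And>l b z. separated L unit_cube (cell z) (box_at b l) \<Longrightarrow>
      (\<integral>\<^sup>+\<xi>. pair_count z \<xi> * void (box_at b l) \<xi> \<partial>P) \<le> rho P 2 * ennreal (void_prob l)"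
  obtains K where "K \<ge> 0" "\<And>l b z. 1 \<le> l \<Longrightarrow> separated L unit_cube (cell z) (box_at b l) \<Longrightarrow>
      (\<integral>\<^sup>+\<xi>. pair_count z \<xi> * void (box_at b l) \<xi> \<partial>P) \<le> ennreal (K * l powr - \<alpha>)"
proof -
  obtain r where r: "rho P 2 = ennreal r" "r \<ge> 0" using rho by (cases "rho P 2") auto
  obtain \<kappa> where \<kappa>: "\<kappa> > 0" "\<And>l. l \<ge> 1 \<Longrightarrow> void_prob l \<le> \<kappa> * l powr - \<alpha>"
    using \<open>cond_C P \<alpha>\<close> cond_C_iff by blast
  have "(\<integral>\<^sup>+\<xi>. pair_count z \<xi> * void (box_at b l) \<xi> \<partial>P) \<le> ennreal (r * \<kappa> * l powr - \<alpha>)"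
    if "1 \<le> l" "separated L unit_cube (cell z) (box_at b l)" for l b z
  proof -
    have "(\<integral>\<^sup>+\<xi>. pair_count z \<xi> * void (box_at b l) \<xi> \<partial>P) \<le> ennreal r * ennreal (void_prob l)"
      using corr[OF that(2)] r by simp
    also have "\<dots> \<le> ennreal r * ennreal (\<kappa> * l powr - \<alpha>)"
      using \<kappa>(2)[OF that(1)] by (intro mult_left_mono ennreal_leI) auto
    finally show ?thesis using r \<kappa>(1) by (simp add: ennreal_mult mult.assoc)
  qed
  then show thesis using that[of "r * \<kappa>"] r \<kappa> by simp
qed

section \<open>Finite range of dependence\<close>

text \<open>Pointwise distances replace \<open>setdist\<close>, which is \<open>0\<close> as soon as
  one set is empty; hence the two nonemptiness conditions.\<close>

lemma finite_rangeE:
  assumes "finite_range_dep P"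
  obtains L where "L > 0"
    "\<And>A B (f :: 'a set \<Rightarrow> ennreal) (g :: 'a set \<Rightarrow> ennreal). \<lbrakk>A \<in> sets borel; B \<in> sets borel; A \<noteq> {}; B \<noteq> {};
       \<forall>a\<in>A. \<forall>b\<in>B. L \<le> dist a b; f \<in> borel_measurable NN; g \<in> borel_measurable NN\<rbrakk> \<Longrightarrow>
       (\<integral>\<^sup>+\<xi>. f (\<xi> \<inter> A) * g (\<xi> \<inter> B) \<partial>P) = (\<integral>\<^sup>+\<xi>. f (\<xi> \<inter> A) \<partial>P) * (\<integral>\<^sup>+\<xi>. g (\<xi> \<inter> B) \<partial>P)"
proof -
  obtain L where L: "L > 0" "\<And>A B. A \<in> sets borel \<Longrightarrow> B \<in> sets borel \<Longrightarrow> setdist A B \<ge> L \<Longrightarrow>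
      indep_var NN (\<lambda>\<xi>. \<xi> \<inter> A) NN (\<lambda>\<xi>. \<xi> \<inter> B)"
    using assms unfolding finite_range_dep_def by blast
  show thesis
  proof (rule that[OF L(1)])
    fix A B :: "'a set" and f g :: "'a set \<Rightarrow> ennreal"
    assume *: "A \<in> sets borel" "B \<in> sets borel" "A \<noteq> {}" "B \<noteq> {}" "\<forall>a\<in>A. \<forall>b\<in>B. L \<le> dist a b"
      "f \<in> borel_measurable NN" "g \<in> borel_measurable NN"
    then have "setdist A B \<ge> L" by (intro le_setdistI) auto
    then show "(\<integral>\<^sup>+\<xi>. f (\<xi> \<inter> A) * g (\<xi> \<inter> B) \<partial>P) = (\<integral>\<^sup>+\<xi>. f (\<xi> \<inter> A) \<partial>P) * (\<integral>\<^sup>+\<xi>. g (\<xi> \<inter> B) \<partial>P)"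
      using * by (intro indep_var_nn_integral[OF L(2)])
  qed
qed

lemma box_at_nonempty: "l \<ge> 0 \<Longrightarrow> box_at b l \<noteq> {}"
  using mem_box_at[of b b l] by auto

lemma void_prob_nonneg [simp]: "0 \<le> void_prob l"
  by (simp add: void_prob_def)

lemma void_prob_le_1: "void_prob l \<le> 1"
  by (simp add: void_prob_def)

lemma void_prob_antimono:
  assumes "l \<le> m"
  shows "void_prob m \<le> void_prob l"
proof -
  have "Lam l \<subseteq> (Lam m :: 'a set)" using assms by (fastforce simp: mem_Lam)
  then have "{\<xi>\<in>space P. cnt \<xi> (Lam m) = 0} \<subseteq> {\<xi>\<in>space P. cnt \<xi> (Lam l) = 0}"
    by (auto simp: space_P intro: cnt_eq_0_subset[of _ "Lam m"])
  then show ?thesis unfolding void_prob_def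
    by (rule finite_measure_mono) measurable
qed

text \<open>Continuity from above: the cubes exhaust the space, so their void events decrease to the
  event of an empty configuration.\<close>

lemma void_prob_tendsto_0:
  assumes "measure P {\<xi>\<in>space P. \<xi> = {}} = 0"
  shows "(\<lambda>n. void_prob (real n)) \<longlonglongrightarrow> 0"
proof -
  let ?E = "\<lambda>n. {\<xi>\<in>space P. cnt \<xi> (Lam (real n)) = 0}"
  have "(\<lambda>n. measure P (?E n)) \<longlonglongrightarrow> measure P (\<Inter>n. ?E n)"
  proof (rule finite_Lim_measure_decseq)
    show "range ?E \<subseteq> sets P" by auto
    show "decseq ?E"
    proof (rule decseq_SucI)
      fix n
      have "Lam (real n) \<subseteq> (Lam (real (Suc n)) :: 'a set)" by (fastforce simp: mem_Lam)
      then show "?E (Suc n) \<subseteq> ?E n" by (auto simp: space_P intro: cnt_eq_0_subset[of _ "Lam (1 + real n)"])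
    qed
  qed
  moreover have "(\<Inter>n. ?E n) = {\<xi>\<in>space P. \<xi> = {}}"
  proof (intro equalityI subsetI)
    fix \<xi> assume \<xi>: "\<xi> \<in> (\<Inter>n. ?E n)"
    have "x \<notin> \<xi>" for x
    proof
      assume "x \<in> \<xi>"
      obtain n where "norm x \<le> real n" using real_arch_simple by blast
      then have "x \<in> Lam (real n)" unfolding mem_Lam
        using Basis_le_norm order_trans by blast
      moreover have "\<xi> \<inter> Lam (real n) = {}"
        using \<xi> cnt_eq_0_iff[of \<xi> "Lam (real n)"] by (simp add: space_P)
      ultimately show False using \<open>x \<in> \<xi>\<close> by blast
    qed
    then show "\<xi> \<in> {\<xi>\<in>space P. \<xi> = {}}" using \<xi> by auto
  qed (auto simp: cnt_def)
  ultimately show ?thesis using assms by (simp add: void_prob_def)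
qed

text \<open>The cube of half-side \<open>3 * l\<close> contains two boxes of half-side
  \<open>l\<close>, centred at plus and minus \<open>2 * l\<close> times a basis vector. Their gap
  is at least \<open>2 * l \<ge> L\<close>, so their void events are independent.\<close>

lemma void_prob_triple:
  assumes "finite_range_dep P"
  obtains L where "L > 0" "\<And>l. L \<le> l \<Longrightarrow> void_prob (3 * l) \<le> void_prob l * void_prob l"
proof -
  obtain L where L: "L > 0"
    "\<And>A B (f :: 'a set \<Rightarrow> ennreal) (g :: 'a set \<Rightarrow> ennreal). \<lbrakk>A \<in> sets borel; B \<in> sets borel; A \<noteq> {}; B \<noteq> {};
       \<forall>a\<in>A. \<forall>b\<in>B. L \<le> dist a b; f \<in> borel_measurable NN; g \<in> borel_measurable NN\<rbrakk> \<Longrightarrow>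
       (\<integral>\<^sup>+\<xi>. f (\<xi> \<inter> A) * g (\<xi> \<inter> B) \<partial>P) = (\<integral>\<^sup>+\<xi>. f (\<xi> \<inter> A) \<partial>P) * (\<integral>\<^sup>+\<xi>. g (\<xi> \<inter> B) \<partial>P)"
    using finite_rangeE[OF assms] by blast
  have "void_prob (3 * l) \<le> void_prob l * void_prob l" if l: "L \<le> l" for l
  proof -
    obtain e :: 'a where e: "e \<in> Basis" by (meson nonempty_Basis ex_in_conv)
    define A B where "A = box_at ((2 * l) *\<^sub>R e) l" and "B = box_at (- (2 * l) *\<^sub>R e) l"
    have shifted: "box_at (t *\<^sub>R e) l \<subseteq> Lam (3 * l)" if "\<bar>t\<bar> \<le> 2 * l" for t
    proof
      fix x assume x: "x \<in> box_at (t *\<^sub>R e) l"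
      show "x \<in> Lam (3 * l)" unfolding mem_Lam
      proof
        fix i :: 'a assume i: "i \<in> Basis"
        have "\<bar>x \<bullet> i - t * (e \<bullet> i)\<bar> \<le> l" using x i by (simp add: mem_box_at inner_simps)
        moreover have "\<bar>t * (e \<bullet> i)\<bar> \<le> 2 * l" using that e i by (simp add: inner_Basis)
        ultimately show "\<bar>x \<bullet> i\<bar> \<le> 3 * l" by linarith
      qed
    qed
    have sub: "A \<subseteq> Lam (3 * l)" "B \<subseteq> Lam (3 * l)"
      unfolding A_def B_def by (intro shifted; use l L(1) in simp)+
    have far: "\<forall>a\<in>A. \<forall>b\<in>B. L \<le> dist a b"
    proof (intro ballI)
      fix a b assume "a \<in> A" "b \<in> B"
      then have "\<bar>(a - (2 * l) *\<^sub>R e) \<bullet> e\<bar> \<le> l" "\<bar>(b - (- (2 * l) *\<^sub>R e)) \<bullet> e\<bar> \<le> l"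
        using e unfolding A_def B_def mem_box_at by blast+
      then have "2 * l \<le> \<bar>(a - b) \<bullet> e\<bar>" using e by (simp add: inner_simps)
      also have "\<dots> \<le> dist a b" using Basis_le_norm[OF e] by (simp add: dist_norm)
      finally show "L \<le> dist a b" using l L(1) by simp
    qed
    have cut: "void V (\<xi> \<inter> V) = void V \<xi>" for V \<xi> by (simp add: void_def cnt_Int)
    have "ennreal (void_prob (3 * l)) = (\<integral>\<^sup>+\<xi>. void (Lam (3 * l)) \<xi> \<partial>P)"
      by (simp add: nn_integral_void void_prob_def)
    also have "\<dots> \<le> (\<integral>\<^sup>+\<xi>. void A (\<xi> \<inter> A) * void B (\<xi> \<inter> B) \<partial>P)"
    proof (rule nn_integral_mono)
      fix \<xi> assume "\<xi> \<in> space P"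
      then show "void (Lam (3 * l)) \<xi> \<le> void A (\<xi> \<inter> A) * void B (\<xi> \<inter> B)"
        using sub cnt_eq_0_subset[of \<xi> "Lam (3 * l)"] by (auto simp: space_P void_def cnt_Int)
    qed
    also have "\<dots> = (\<integral>\<^sup>+\<xi>. void A (\<xi> \<inter> A) \<partial>P) * (\<integral>\<^sup>+\<xi>. void B (\<xi> \<inter> B) \<partial>P)"
      using l L(1) far by (intro L(2)) (auto simp: A_def B_def box_at_nonempty intro!: measurable_void)
    also have "\<dots> = ennreal (void_prob l * void_prob l)"
      unfolding cut by (simp add: A_def B_def nn_integral_void_box ennreal_mult)
    finally show ?thesis by (simp add: ennreal_le_iff)
  qed
  with L(1) show thesis using that by blast
qed

text \<open>Start at a scale \<open>m\<close> with void probability below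
  \<open>3 powr - \<alpha>\<close>. By \<open>void_prob_triple\<close> and monotonicity, each
  tripling of the scale gains at least this factor, which is decay of order \<open>\<alpha>\<close>
  along \<open>3 ^ k * m\<close>; monotonicity fills in the other scales.\<close>

lemma cond_C_of_finite_range:
  assumes fin: "finite_range_dep P" and empty: "measure P {\<xi>\<in>space P. \<xi> = {}} = 0" and "\<alpha> > 0"
  shows "cond_C P \<alpha>"
proof -
  obtain L where L: "L > 0" "\<And>l. L \<le> l \<Longrightarrow> void_prob (3 * l) \<le> void_prob l * void_prob l"
    using void_prob_triple[OF fin] by blast
  have "eventually (\<lambda>n. void_prob (real n) < 3 powr - \<alpha>) sequentially"
    using void_prob_tendsto_0[OF empty] by (rule order_tendstoD) simp
  moreover have "eventually (\<lambda>n. L \<le> real n) sequentially"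
    using filterlim_real_sequentially by (auto simp: filterlim_at_top)
  ultimately have "eventually (\<lambda>n. void_prob (real n) < 3 powr - \<alpha> \<and> L \<le> real n) sequentially"
    by (rule eventually_conj)
  then obtain n where n: "void_prob (real n) < 3 powr - \<alpha>" "L \<le> real n"
    using eventually_happens sequentially_bot by blast
  define m where "m = real n"
  have m: "m > 0" "L \<le> m" using n L by (auto simp: m_def)
  have geo: "void_prob (3 ^ k * m) \<le> (3 powr - \<alpha>) ^ k" for k
  proof (induction k)
    case 0
    show ?case by (simp add: void_prob_le_1)
  next
    case (Suc k)
    have "m \<le> 3 ^ k * m" using m by simp
    then have "void_prob (3 * (3 ^ k * m)) \<le> void_prob (3 ^ k * m) * void_prob (3 ^ k * m)"
      using m by (intro L(2)) linarith
    also have "\<dots> \<le> 3 powr - \<alpha> * (3 powr - \<alpha>) ^ k"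
      using Suc void_prob_antimono[OF \<open>m \<le> 3 ^ k * m\<close>] n by (intro mult_mono) (auto simp: m_def)
    finally show ?case by (simp add: mult.assoc)
  qed
  have "void_prob l \<le> (3 * m) powr \<alpha> * l powr - \<alpha>" if l: "l \<ge> 1" for l
  proof -
    obtain j where "l / m < 3 ^ j" using real_arch_pow[of 3 "l / m"] by auto
    also have "(3::real) ^ j \<le> 3 ^ Suc j" by simp
    finally have "l < 3 ^ Suc j * m" using m by (simp add: field_simps)
    \<comment> \<open>For \<open>k > 0\<close> minimality gives \<open>3 ^ k * m \<le> l\<close>.
      The case \<open>k = 0\<close> includes \<open>l\<close> below \<open>m\<close>, where the
      bound is just \<open>1\<close>.\<close>
    then obtain k where k: "l < 3 ^ Suc k * m" "\<And>i. i < k \<Longrightarrow> 3 ^ Suc i * m \<le> l"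
      using exists_least_iff[of "\<lambda>k. l < 3 ^ Suc k * m"] by (auto simp: not_less)
    have "void_prob l \<le> (3 powr - \<alpha>) ^ k"
    proof (cases k)
      case 0
      then show ?thesis by (simp add: void_prob_le_1)
    next
      case (Suc i)
      then have "void_prob l \<le> void_prob (3 ^ k * m)"
        using k(2)[of i] by (intro void_prob_antimono) simp
      then show ?thesis using geo[of k] by linarith
    qed
    also have "(3 powr - \<alpha>) ^ k = (3 ^ k) powr - \<alpha>"
      by (simp add: powr_realpow[symmetric] powr_powr powr_power mult.commute)
    also have "\<dots> \<le> (l / (3 * m)) powr - \<alpha>"
      using k(1) l m \<open>\<alpha> > 0\<close> by (intro powr_mono2') (auto simp: field_simps)
    also have "\<dots> = (3 * m) powr \<alpha> * l powr - \<alpha>"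
      using l m by (simp add: powr_divide powr_minus field_simps)
    finally show ?thesis .
  qed
  then show ?thesis unfolding cond_C_iff using m by (intro exI[of _ "(3 * m) powr \<alpha>"]) auto
qed

lemma correlation_finite_range:
  assumes "finite_range_dep P"
  obtains L where "L > 0" "\<And>l b z. separated L unit_cube (cell z) (box_at b l) \<Longrightarrow>
      (\<integral>\<^sup>+\<xi>. pair_count z \<xi> * void (box_at b l) \<xi> \<partial>P) \<le> rho P 2 * ennreal (void_prob l)"
proof -
  obtain L where L: "L > 0"
    "\<And>A B (f :: 'a set \<Rightarrow> ennreal) (g :: 'a set \<Rightarrow> ennreal). \<lbrakk>A \<in> sets borel; B \<in> sets borel; A \<noteq> {}; B \<noteq> {};
       \<forall>a\<in>A. \<forall>b\<in>B. L \<le> dist a b; f \<in> borel_measurable NN; g \<in> borel_measurable NN\<rbrakk> \<Longrightarrow>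
       (\<integral>\<^sup>+\<xi>. f (\<xi> \<inter> A) * g (\<xi> \<inter> B) \<partial>P) = (\<integral>\<^sup>+\<xi>. f (\<xi> \<inter> A) \<partial>P) * (\<integral>\<^sup>+\<xi>. g (\<xi> \<inter> B) \<partial>P)"
    using finite_rangeE[OF assms] by blast
  have "(\<integral>\<^sup>+\<xi>. pair_count z \<xi> * void (box_at b l) \<xi> \<partial>P) \<le> rho P 2 * ennreal (void_prob l)"
    if sep: "separated L unit_cube (cell z) (box_at b l)" for l b z
  proof -
    define A B where "A = unit_cube \<union> cell z" and "B = box_at b l"
    have cut: "pair_count z (\<xi> \<inter> A) = pair_count z \<xi>" "void B (\<xi> \<inter> B) = void B \<xi>" for \<xi>
      by (simp_all add: pair_count_def void_def cnt_Int A_def)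
    have "0 \<in> A" by (simp add: A_def unit_cube_eq_cell mem_cell)
    have "(\<integral>\<^sup>+\<xi>. pair_count z \<xi> * void B \<xi> \<partial>P) = (\<integral>\<^sup>+\<xi>. pair_count z \<xi> \<partial>P) * (\<integral>\<^sup>+\<xi>. void B \<xi> \<partial>P)"
    \<comment> \<open>For \<open>l < 0\<close> the box is empty and its void indicator is constantly
      \<open>1\<close>; the independence statement covers nonempty sets.\<close>
    proof (cases "B = {}")
      case True
      then have "void B = (\<lambda>_. 1)" by (auto simp: void_def cnt_def)
      then show ?thesis by (simp add: emeasure_space_1)
    next
      case False
      have "(\<integral>\<^sup>+\<xi>. pair_count z (\<xi> \<inter> A) * void B (\<xi> \<inter> B) \<partial>P)
        = (\<integral>\<^sup>+\<xi>. pair_count z (\<xi> \<inter> A) \<partial>P) * (\<integral>\<^sup>+\<xi>. void B (\<xi> \<inter> B) \<partial>P)"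
        using sep False \<open>0 \<in> A\<close> by (intro L(2)) (auto simp: separated_def A_def B_def intro!: measurable_void)
      then show ?thesis by (simp only: cut)
    qed
    also have "\<dots> \<le> rho P 2 * ennreal (void_prob l)"
      by (intro mult_mono pair_count_le) (auto simp: B_def nn_integral_void_box)
    finally show ?thesis by (simp add: B_def)
  qed
  with L(1) show thesis using that by blast
qed

section \<open>Positive association\<close>

text \<open>The indicator \<open>?H\<close> that the box is occupied increases with its count, so it
  is positively correlated with the truncated product \<open>?F\<close>. Passing to
  \<open>1 - ?H\<close> reverses the inequality, and monotone convergence removes the
  truncation.\<close>

lemma correlation_positive_assoc:
  assumes pa: "positive_assoc P" and "L > 0" and sep: "separated L unit_cube (cell z) (box_at b l)"
  shows "(\<integral>\<^sup>+\<xi>. pair_count z \<xi> * void (box_at b l) \<xi> \<partial>P) \<le> rho P 2 * ennreal (void_prob l)"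
proof -
  define V where "V = box_at b l"
  define X where "X \<xi> = real (cnt \<xi> unit_cube * cnt \<xi> (cell z))" for \<xi>
  define A where "A i = (if i = 0 then unit_cube else cell z)" for i :: nat
  define h where "h v = (if v 0 > 0 then 1 else 0 :: real)" for v :: "nat \<Rightarrow> real"
  have [measurable]: "X \<in> borel_measurable P" unfolding X_def by measurable
  have V: "V \<in> sets borel" "bounded V" by (simp_all add: V_def)
  have [measurable]: "(\<lambda>\<xi>. cnt \<xi> V) \<in> P \<rightarrow>\<^sub>M count_space UNIV" using V by (rule measurable_cnt_P)
  have h: "h (count_vec 1 (\<lambda>_. V) \<xi>) = (if cnt \<xi> V = 0 then 0 else 1)" for \<xi>
    by (simp add: h_def count_vec_def)
  \<comment> \<open>\<open>N_0 N_z\<close> itself need not have the second moment that positive association requires\<close>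
  have truncated: "(\<integral>\<^sup>+\<xi>. ennreal (min (X \<xi>) (real M)) * void V \<xi> \<partial>P) \<le> rho P 2 * ennreal (void_prob l)" for M :: nat
  proof -
    define f where "f v = min (v 0 * v 1) (real M)" for v :: "nat \<Rightarrow> real"
    let ?F = "\<lambda>\<xi>. min (X \<xi>) (real M)" and ?H = "\<lambda>\<xi>. if cnt \<xi> V = 0 then 0 else 1 :: real"
    have f: "f (count_vec 2 A \<xi>) = ?F \<xi>" for \<xi>
      by (simp add: f_def count_vec_def A_def X_def)
    have F: "0 \<le> ?F \<xi>" "?F \<xi> \<le> real M" for \<xi> by (simp_all add: X_def)
    have int [simp]: "integrable P ?F" "integrable P (\<lambda>\<xi>. (?F \<xi>)\<^sup>2)" "integrable P ?H"
      "integrable P (\<lambda>\<xi>. (?H \<xi>)\<^sup>2)" "integrable P (\<lambda>\<xi>. ?F \<xi> * ?H \<xi>)"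
    proof -
      show "integrable P ?F" using F by (intro integrable_const_bound[where B = "real M"]) auto
      show "integrable P (\<lambda>\<xi>. (?F \<xi>)\<^sup>2)"
        using power_mono[OF F(2) F(1), where n = 2] by (intro integrable_const_bound[where B = "(real M)\<^sup>2"]) auto
      show "integrable P ?H" by (intro integrable_const_bound[where B = 1]) auto
      show "integrable P (\<lambda>\<xi>. (?H \<xi>)\<^sup>2)" by (intro integrable_const_bound[where B = 1]) auto
      show "integrable P (\<lambda>\<xi>. ?F \<xi> * ?H \<xi>)"
        using F by (intro integrable_const_bound[where B = "real M"]) auto
    qed
    have incr: "weakly_incr 2 f" "weakly_incr 1 h"
    proof -
      \<comment> \<open>A product of coordinates is monotone on nonnegative vectors, the domain to
        which \<open>weakly_incr\<close> refers.\<close>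
      have "u 0 * u 1 \<le> v 0 * v 1" if "u \<in> nonneg_vecs 2" "v \<in> nonneg_vecs 2" "\<forall>i<2. u i \<le> v i" for u v
        using that by (intro mult_mono) (auto simp: nonneg_vecs_def)
      then show "weakly_incr 2 f" unfolding weakly_incr_def f_def by (intro ballI impI min.mono order_refl) blast
      show "weakly_incr 1 h" unfolding weakly_incr_def h_def by auto
    qed
    have disj: "A i \<inter> V = {}" "unit_cube \<inter> cell z = {}" for i
    proof -
      have "a \<notin> V" if "a \<in> unit_cube \<union> cell z" for a
      proof
        assume "a \<in> V"
        then have "L \<le> dist a a" using sep that unfolding separated_def V_def by blast
        then show False using \<open>L > 0\<close> by simp
      qed
      then show "A i \<inter> V = {}" by (auto simp: A_def)
      show "unit_cube \<inter> cell z = {}" using sep by (simp add: separated_def)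
    qed
    have "(\<integral>\<xi>. f (count_vec 2 A \<xi>) * h (count_vec 1 (\<lambda>_. V) \<xi>) \<partial>P)
        - (\<integral>\<xi>. f (count_vec 2 A \<xi>) \<partial>P) * (\<integral>\<xi>. h (count_vec 1 (\<lambda>_. V) \<xi>) \<partial>P) \<ge> 0"
    proof (rule pa[unfolded positive_assoc_def, rule_format, of 2 f 1 h A "\<lambda>_. V"])
      show "integrable P (\<lambda>\<xi>. (f (count_vec 2 A \<xi>))\<^sup>2)" unfolding f by (rule int)
      show "integrable P (\<lambda>\<xi>. (h (count_vec 1 (\<lambda>_. V) \<xi>))\<^sup>2)" unfolding h by (rule int)
      show "A i \<inter> A i' = {}" if "i < 2" "i' < 2" "i \<noteq> i'" for i i'
        using that disj(2) by (auto simp: A_def)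
    qed (use incr V disj(1) in \<open>auto simp: A_def\<close>)
    then have "(\<integral>\<xi>. ?F \<xi> \<partial>P) * (\<integral>\<xi>. ?H \<xi> \<partial>P) \<le> (\<integral>\<xi>. ?F \<xi> * ?H \<xi> \<partial>P)"
      unfolding f h by simp
    moreover have "(\<integral>\<xi>. ?H \<xi> \<partial>P) = 1 - void_prob l"
    proof -
      have "(\<integral>\<xi>. ?H \<xi> \<partial>P) = (\<integral>\<xi>. 1 - indicator {\<xi>\<in>space P. cnt \<xi> V = 0} \<xi> \<partial>P)"
        by (intro Bochner_Integration.integral_cong) auto
      also have "\<dots> = 1 - measure P {\<xi>\<in>space P. cnt \<xi> V = 0}"
        by (subst Bochner_Integration.integral_diff)
          (auto simp: prob_space emeasure_eq_measure intro!: integrable_real_indicator)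
      finally show ?thesis by (simp add: V_def measure_void_box)
    qed
    ultimately have "(\<integral>\<xi>. ?F \<xi> - ?F \<xi> * ?H \<xi> \<partial>P) \<le> (\<integral>\<xi>. ?F \<xi> \<partial>P) * void_prob l"
      by (simp add: algebra_simps)
    \<comment> \<open>Pointwise, \<open>?F \<xi> - ?F \<xi> * ?H \<xi>\<close> is
      \<open>?F \<xi>\<close> when the box is empty and \<open>0\<close> otherwise.\<close>
    moreover have "(\<integral>\<^sup>+\<xi>. ennreal (?F \<xi>) * void V \<xi> \<partial>P) = ennreal (\<integral>\<xi>. ?F \<xi> - ?F \<xi> * ?H \<xi> \<partial>P)"
      using F by (subst nn_integral_eq_integral[symmetric])
        (auto intro!: nn_integral_cong simp: void_def)
    ultimately have "(\<integral>\<^sup>+\<xi>. ennreal (?F \<xi>) * void V \<xi> \<partial>P) \<le> ennreal (\<integral>\<xi>. ?F \<xi> \<partial>P) * ennreal (void_prob l)"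
      using F by (simp add: ennreal_mult[symmetric] ennreal_leI)
    also have "ennreal (\<integral>\<xi>. ?F \<xi> \<partial>P) = (\<integral>\<^sup>+\<xi>. ennreal (?F \<xi>) \<partial>P)"
      using F by (intro nn_integral_eq_integral[symmetric]) auto
    also have "\<dots> \<le> (\<integral>\<^sup>+\<xi>. pair_count z \<xi> \<partial>P)"
      by (intro nn_integral_mono) (auto simp: pair_count_def X_def intro!: ennreal_leI)
    also have "\<dots> \<le> rho P 2" by (rule pair_count_le)
    finally show ?thesis by (simp add: mult_right_mono)
  qed
  have "pair_count z \<xi> = (SUP M. ennreal (min (X \<xi>) (real M)))" for \<xi>
  proof (rule antisym)
    obtain M where "X \<xi> \<le> real M" using real_arch_simple by blast
    then have "pair_count z \<xi> = ennreal (min (X \<xi>) (real M))" by (simp add: pair_count_def X_def)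
    also have "\<dots> \<le> (SUP M. ennreal (min (X \<xi>) (real M)))" by (rule SUP_upper) simp
    finally show "pair_count z \<xi> \<le> (SUP M. ennreal (min (X \<xi>) (real M)))" .
    show "(SUP M. ennreal (min (X \<xi>) (real M))) \<le> pair_count z \<xi>"
      by (rule SUP_least) (auto simp: pair_count_def X_def intro!: ennreal_leI)
  qed
  then have "(\<integral>\<^sup>+\<xi>. pair_count z \<xi> * void V \<xi> \<partial>P)
    = (\<integral>\<^sup>+\<xi>. (SUP M. ennreal (min (X \<xi>) (real M)) * void V \<xi>) \<partial>P)"
    by (simp add: SUP_mult_right_ennreal)
  also have "\<dots> = (SUP M. \<integral>\<^sup>+\<xi>. ennreal (min (X \<xi>) (real M)) * void V \<xi> \<partial>P)"
    by (rule nn_integral_monotone_convergence_SUP)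
      (auto simp: V_def incseq_def le_fun_def intro!: mult_right_mono ennreal_leI)
  also have "\<dots> \<le> rho P 2 * ennreal (void_prob l)" by (rule SUP_least) (rule truncated)
  finally show ?thesis by (simp add: V_def)
qed

section \<open>Assembly of the three cases\<close>

lemma edge_sum_finite_cases:
  assumes "\<zeta> \<ge> 0" and empty: "measure P {\<xi>\<in>space P. \<xi> = {}} = 0"
    and cases: "(\<exists>\<gamma>>2. rho P \<gamma> < \<infinity> \<and>
            (\<exists>\<alpha>. \<alpha> > \<gamma> / (\<gamma> - 2) * (real DIM('a) + \<zeta>) \<and> cond_C P \<alpha>))
       \<or> (rho P 2 < \<infinity> \<and> finite_range_dep P)
       \<or> (rho P 2 < \<infinity> \<and> positive_assoc P \<and> (\<exists>\<alpha>. \<alpha> > real DIM('a) + \<zeta> \<and> cond_C P \<alpha>))"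
  shows "(\<integral>\<^sup>+\<xi>. (\<Sum>x\<in>\<xi> \<inter> unit_cube. \<integral>\<^sup>+w. indicator {w. dt_adj (tau x \<xi>) w 0} w
            * ennreal (norm w powr \<zeta>) \<partial>count_space UNIV) \<partial>P) < \<infinity>"
  using cases
proof (elim disjE exE conjE)
  fix \<gamma> \<alpha> :: real
  assume *: "\<gamma> > 2" "rho P \<gamma> < \<infinity>" "\<alpha> > \<gamma> / (\<gamma> - 2) * (real DIM('a) + \<zeta>)" "cond_C P \<alpha>"
  have rho2: "rho P 2 < \<infinity>" using rho_mono[of 2 \<gamma>] * by (auto intro: le_less_trans)
  \<comment> \<open>The threshold on \<open>\<alpha>\<close> in (H1) says exactly that the reduced
    exponent still exceeds \<open>d + \<zeta>\<close>.\<close>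
  have \<beta>: "real DIM('a) + \<zeta> < \<alpha> * (\<gamma> - 2) / \<gamma>"
    using * by (simp add: field_simps)
  show ?thesis
  proof (rule decay_of_higher_moment[OF *(1,2,4)])
    fix K assume "K \<ge> 0" "\<And>l b z. 1 \<le> l \<Longrightarrow>
      (\<integral>\<^sup>+\<xi>. pair_count z \<xi> * void (box_at b l) \<xi> \<partial>P) \<le> ennreal (K * l powr - (\<alpha> * (\<gamma> - 2) / \<gamma>))"
    then show ?thesis by (rule edge_sum_finite[OF zero_less_one _ assms(1) \<beta> rho2])
  qed
next
  assume *: "rho P 2 < \<infinity>" "finite_range_dep P"
  \<comment> \<open>Finite range yields every positive exponent; this one lies above the threshold
    \<open>d + \<zeta>\<close>.\<close>
  define \<alpha> where "\<alpha> = real DIM('a) + \<zeta> + 1"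
  have \<alpha>: "real DIM('a) + \<zeta> < \<alpha>" "\<alpha> > 0" using assms(1) by (simp_all add: \<alpha>_def)
  have C: "cond_C P \<alpha>" using \<alpha>(2) by (rule cond_C_of_finite_range[OF *(2) empty])
  show ?thesis
  proof (rule correlation_finite_range[OF *(2)])
    fix L assume L: "L > 0" "\<And>l b z. separated L unit_cube (cell z) (box_at b l) \<Longrightarrow>
      (\<integral>\<^sup>+\<xi>. pair_count z \<xi> * void (box_at b l) \<xi> \<partial>P) \<le> rho P 2 * ennreal (void_prob l)"
    show ?thesis
    proof (rule decay_of_negative_correlation[OF *(1) C L(2)])
      fix K assume "K \<ge> 0" "\<And>l b z. 1 \<le> l \<Longrightarrow> separated L unit_cube (cell z) (box_at b l) \<Longrightarrow>
        (\<integral>\<^sup>+\<xi>. pair_count z \<xi> * void (box_at b l) \<xi> \<partial>P) \<le> ennreal (K * l powr - \<alpha>)"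
      then show ?thesis by (rule edge_sum_finite[OF L(1) _ assms(1) \<alpha>(1) *(1)])
    qed
  qed
next
  fix \<alpha>
  assume *: "rho P 2 < \<infinity>" "positive_assoc P" "\<alpha> > real DIM('a) + \<zeta>" "cond_C P \<alpha>"
  show ?thesis
  \<comment> \<open>Any positive distance makes the box disjoint from the cubes, as positive
    association asks; \<open>1\<close> is an arbitrary choice.\<close>
  proof (rule decay_of_negative_correlation[OF *(1,4) correlation_positive_assoc[OF *(2) zero_less_one]])
    fix K assume "K \<ge> 0" "\<And>l b z. 1 \<le> l \<Longrightarrow> separated 1 unit_cube (cell z) (box_at b l) \<Longrightarrow>
      (\<integral>\<^sup>+\<xi>. pair_count z \<xi> * void (box_at b l) \<xi> \<partial>P) \<le> ennreal (K * l powr - \<alpha>)"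
    then show ?thesis by (rule edge_sum_finite[OF zero_less_one _ assms(1) *(3,1)])
  qed
qed

end

section \<open>Stationarity of the law, and the theorem\<close>

text \<open>The action preserves the measure, and on a set of full measure it carries
  \<open>hat\<close> to its translate, so a count in a translated set has the law of the original
  count.\<close>

lemma setting_stationary_process:
  fixes \<Omega> :: "'w measure" and \<theta> :: "'a::euclidean_space \<Rightarrow> 'w \<Rightarrow> 'w"
    and hat :: "'w \<Rightarrow> 'a set" and c :: "'w \<Rightarrow> 'a \<Rightarrow> 'a \<Rightarrow> real"
  assumes "setting \<Omega> \<theta> hat c"
  shows "stationary_process (distr \<Omega> NN hat)"
    and "measure (distr \<Omega> NN hat) {\<xi>\<in>space (distr \<Omega> NN hat). \<xi> = {}} = 0"
proof -
  interpret prob_space \<Omega> using assms by (simp add: setting_def)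
  note set = assms[unfolded setting_def]
  have hat [measurable]: "hat \<in> \<Omega> \<rightarrow>\<^sub>M NN" and act: "(\<lambda>(x, \<omega>). \<theta> x \<omega>) \<in> borel \<Otimes>\<^sub>M \<Omega> \<rightarrow>\<^sub>M \<Omega>"
    and unit: "\<forall>\<omega>\<in>space \<Omega>. \<theta> 0 \<omega> = \<omega>"
    and comp: "\<forall>x y. \<forall>\<omega>\<in>space \<Omega>. \<theta> x (\<theta> y \<omega>) = \<theta> (x + y) \<omega>"
    and inv: "\<forall>x. \<forall>A\<in>sets \<Omega>. emeasure \<Omega> (\<theta> x ` A) = emeasure \<Omega> A"
    and empty: "emeasure \<Omega> {\<omega>\<in>space \<Omega>. hat \<omega> = {}} = 0"
    using set by - (elim conjE, assumption)+
  note group = unit[rule_format] comp[rule_format] and inv = inv[rule_format]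
  obtain \<Omega>s where \<Omega>s: "emeasure \<Omega> \<Omega>s = 1"
    "\<forall>\<omega>\<in>\<Omega>s. (\<forall>x. hat (\<theta> x \<omega>) = tau x (hat \<omega>)) \<and>
       (\<forall>x y z. dt_adj (hat \<omega>) y z \<longrightarrow> c (\<theta> x \<omega>) (y - x) (z - x) = c \<omega> y z)"
    using set by (elim conjE bexE) (rule that)
  have \<theta> [measurable]: "\<theta> x \<in> \<Omega> \<rightarrow>\<^sub>M \<Omega>" for x
    using measurable_compose[OF measurable_Pair1'[of x borel \<Omega>] act] by simp
  have \<theta>_space: "\<theta> x \<omega> \<in> space \<Omega>" if "\<omega> \<in> space \<Omega>" for x \<omega>
    using \<theta> that by (rule measurable_space)
  have pres: "distr \<Omega> \<Omega> (\<theta> x) = \<Omega>" for x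
  proof (rule measure_eqI)
    fix A assume "A \<in> sets (distr \<Omega> \<Omega> (\<theta> x))"
    then have A: "A \<in> sets \<Omega>" by simp
    \<comment> \<open>(A1) speaks of images, \<open>distr\<close> of preimages; the group law
      exchanges them through the inverse \<open>\<theta> (- x)\<close>.\<close>
    have "\<theta> x -` A \<inter> space \<Omega> = \<theta> (- x) ` A"
    proof (intro equalityI subsetI)
      fix \<omega> assume "\<omega> \<in> \<theta> x -` A \<inter> space \<Omega>"
      then show "\<omega> \<in> \<theta> (- x) ` A" by (intro image_eqI[of _ _ "\<theta> x \<omega>"]) (auto simp: group)
    next
      fix \<omega> assume "\<omega> \<in> \<theta> (- x) ` A"
      then show "\<omega> \<in> \<theta> x -` A \<inter> space \<Omega>"
        using sets.sets_into_space[OF A] by (auto simp: group \<theta>_space subset_iff)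
    qed
    then show "emeasure (distr \<Omega> \<Omega> (\<theta> x)) A = emeasure \<Omega> A"
      using A inv by (simp add: emeasure_distr)
  qed simp
  show "stationary_process (distr \<Omega> NN hat)"
  proof (intro stationary_process.intro stationary_process_axioms.intro prob_space_distr hat)
    show "sets (distr \<Omega> NN hat) = sets NN" by simp
    fix f :: "nat \<Rightarrow> ennreal" and A :: "'a set" and z
    assume A: "A \<in> sets borel" "bounded A"
    have [measurable]: "(\<lambda>\<xi>. f (cnt \<xi> A)) \<in> borel_measurable NN"
      by (rule measurable_compose[OF measurable_cnt[OF A]]) simp
    have "(+) z ` A \<in> sets borel" "bounded ((+) z ` A)"
    proof -
      have "(+) z ` A = (\<lambda>y. y - z) -` A \<inter> space borel"
      proof (intro equalityI subsetI)
        fix y assume "y \<in> (\<lambda>y. y - z) -` A \<inter> space borel"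
        then show "y \<in> (+) z ` A" by (intro image_eqI[of _ _ "y - z"]) auto
      qed auto
      also have "\<dots> \<in> sets borel" using A(1) by (intro measurable_sets[of _ borel borel]) auto
      finally show "(+) z ` A \<in> sets borel" .
      show "bounded ((+) z ` A)" using A(2) by (rule bounded_translation)
    qed
    then have [measurable]: "(\<lambda>\<xi>. f (cnt \<xi> ((+) z ` A))) \<in> borel_measurable NN"
      by (intro measurable_compose[OF measurable_cnt]) auto
    have "(\<integral>\<^sup>+\<xi>. f (cnt \<xi> ((+) z ` A)) \<partial>distr \<Omega> NN hat) = (\<integral>\<^sup>+\<omega>. f (cnt (tau z (hat \<omega>)) A) \<partial>\<Omega>)"
      by (simp add: nn_integral_distr cnt_tau)
    also have "\<dots> = (\<integral>\<^sup>+\<omega>. f (cnt (hat (\<theta> z \<omega>)) A) \<partial>\<Omega>)"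
    proof (rule nn_integral_cong_AE)
      have "AE \<omega> in \<Omega>. \<omega> \<in> \<Omega>s" using \<Omega>s(1) by (intro AE_prob_1) (simp add: measure_def)
      then show "AE \<omega> in \<Omega>. f (cnt (tau z (hat \<omega>)) A) = f (cnt (hat (\<theta> z \<omega>)) A)"
        by (rule AE_mp) (simp add: \<Omega>s(2) AE_I2)
    qed
    also have "\<dots> = (\<integral>\<^sup>+\<omega>. f (cnt (hat \<omega>) A) \<partial>distr \<Omega> \<Omega> (\<theta> z))"
      by (rule nn_integral_distr[symmetric]) measurable
    also have "\<dots> = (\<integral>\<^sup>+\<xi>. f (cnt \<xi> A) \<partial>distr \<Omega> NN hat)"
      by (simp add: pres nn_integral_distr)
    finally show "(\<integral>\<^sup>+\<xi>. f (cnt \<xi> ((+) z ` A)) \<partial>distr \<Omega> NN hat) = (\<integral>\<^sup>+\<xi>. f (cnt \<xi> A) \<partial>distr \<Omega> NN hat)" .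
  qed
  show "measure (distr \<Omega> NN hat) {\<xi>\<in>space (distr \<Omega> NN hat). \<xi> = {}} = 0"
  \<comment> \<open>On a set outside the sigma-algebra \<open>measure\<close> takes the default
    value \<open>0\<close>, so (A1) is called upon only in the measurable case.\<close>
  proof (cases "{\<xi>\<in>space NN. \<xi> = ({} :: 'a set)} \<in> sets NN")
    case True
    have "hat -` {\<xi>\<in>space NN. \<xi> = ({} :: 'a set)} \<inter> space \<Omega> = {\<omega>\<in>space \<Omega>. hat \<omega> = {}}"
      using measurable_space[OF hat] by auto
    then have "measure (distr \<Omega> NN hat) {\<xi>\<in>space NN. \<xi> = ({} :: 'a set)} = measure \<Omega> {\<omega>\<in>space \<Omega>. hat \<omega> = {}}"
      using measure_distr[OF hat True] by simp
    also have "\<dots> = 0" using empty by (rule measure_eq_emeasure_eq_ennreal[OF order_refl, unfolded ennreal_0])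
    finally show ?thesis by simp
  next
    case False
    then show ?thesis by (simp add: measure_notin_sets)
  qed
qed

theorem theorem4p8:
  fixes \<Omega> :: "'w measure" and \<theta> :: "'a::euclidean_space \<Rightarrow> 'w \<Rightarrow> 'w"
    and hat :: "'w \<Rightarrow> 'a set" and c :: "'w \<Rightarrow> 'a \<Rightarrow> 'a \<Rightarrow> real" and \<zeta> :: real
  assumes "setting \<Omega> \<theta> hat c"
    and "\<zeta> \<ge> 0"
    and "(\<exists>\<gamma>>2. rho (distr \<Omega> NN hat) \<gamma> < \<infinity> \<and>
            (\<exists>\<alpha>. \<alpha> > \<gamma> / (\<gamma> - 2) * (real DIM('a) + \<zeta>) \<and> cond_C (distr \<Omega> NN hat) \<alpha>))
       \<or> (rho (distr \<Omega> NN hat) 2 < \<infinity> \<and> finite_range_dep (distr \<Omega> NN hat))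
       \<or> (rho (distr \<Omega> NN hat) 2 < \<infinity> \<and> positive_assoc (distr \<Omega> NN hat) \<and>
            (\<exists>\<alpha>. \<alpha> > real DIM('a) + \<zeta> \<and> cond_C (distr \<Omega> NN hat) \<alpha>))"
  shows "palm_exp (distr \<Omega> NN hat)
           (\<lambda>\<eta>. \<integral>\<^sup>+ x. indicator {x. dt_adj \<eta> x 0} x * ennreal (norm x powr \<zeta>) \<partial>count_space UNIV)
         < \<infinity>"
proof -
  interpret stationary_process "distr \<Omega> NN hat"
    using assms(1) by (rule setting_stationary_process)
  have "intensity (distr \<Omega> NN hat) > 0" using assms(1) by (simp add: setting_def)
  moreover have "(\<integral>\<^sup>+\<xi>. (\<Sum>x\<in>\<xi> \<inter> unit_cube. \<integral>\<^sup>+w. indicator {w. dt_adj (tau x \<xi>) w 0} w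
            * ennreal (norm w powr \<zeta>) \<partial>count_space UNIV) \<partial>distr \<Omega> NN hat) < \<infinity>"
    by (rule edge_sum_finite_cases[OF assms(2) setting_stationary_process(2)[OF assms(1)] assms(3)])
  \<comment> \<open>A quotient in \<open>ennreal\<close> is infinite only if the numerator is
    infinite or the denominator is \<open>0\<close>.\<close>
  ultimately show ?thesis
    unfolding palm_exp_def by (auto simp: less_top[symmetric] ennreal_divide_eq_top_iff)
qed

end
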